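(* The gap problems for both $\mathsf{CSV}$ and $\mathsf{ASV}$ are decidable for games with discounted-sum objectives. That is, for each $\mathsf{VAL}\in\{\mathsf{CSV},\mathsf{ASV}\}$ there is an algorithm which, given a discounted-sum game $\mathcal{G}$ with rational discount factor $0<\lambda<1$, a vertex $v$, a rational gap $\epsilon>0$ and a threshold $c\in\mathbb{Q}$, answers Yes whenever $\mathsf{VAL}(v)>c+\epsilon$ and answers No whenever $\mathsf{VAL}(v)<c-\epsilon$ (with no requirement otherwise).
   Context: A (bi-weighted) arena $\mathcal{A}=(V,E,\langle V_0,V_1\rangle,w_0,w_1)$ consists of a finite set $V$ of vertices, a set $E\subseteq V\times V$ of edges such that every vertex has at least one outgoing edge, a partition $\langle V_0,V_1\rangle$ of $V$ ($V_i$ is owned by Player $i$), and two weight functions $w_0,w_1:E\to\mathbb{Z}$. A play is an infinite path $\pi=\pi_0\pi_1\dots$ of the arena; a history is a non-empty finite prefix of a play. Discounted-sum game with discount factor $0<\lambda<1$: the payoff of Player $i\in\{0,1\}$ for a play $\pi$ is $\mathsf{DS}_i^\lambda(\pi)=\sum_{k=0}^\infty\lambda^k w_i(\pi_k,\pi_{k+1})$. A strategy of Player $i$ is a function mapping each history ending in a vertex $u\in V_i$ to a successor of $u$; $\Sigma_i$ is the set of all strategies of Player $i$. For $v\in V$, $\mathsf{Out}_v(\sigma_0,\sigma_1)$ is the unique play starting in $v$ in which both players follow their strategies. Best-responses of Player 1 to $\sigma_0$: $\mathsf{BR}_1(\sigma_0)=\{\sigma_1\in\Sigma_1\mid \forall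 v\in V\ \forall\sigma_1'\in\Sigma_1:\ \mathsf{DS}_1^\lambda(\mathsf{Out}_v(\sigma_0,\sigma_1))\ge\mathsf{DS}_1^\lambda(\mathsf{Out}_v(\sigma_0,\sigma_1'))\}$ (this set is always non-empty). Stackelberg values: $\mathsf{CSV}(\sigma_0)(v)=\sup_{\sigma_1\in\mathsf{BR}_1(\sigma_0)}\mathsf{DS}_0^\lambda(\mathsf{Out}_v(\sigma_0,\sigma_1))$, $\mathsf{CSV}(v)=\sup_{\sigma_0\in\Sigma_0}\mathsf{CSV}(\sigma_0)(v)$; $\mathsf{ASV}(\sigma_0)(v)=\inf_{\sigma_1\in\mathsf{BR}_1(\sigma_0)}\mathsf{DS}_0^\lambda(\mathsf{Out}_v(\sigma_0,\sigma_1))$, $\mathsf{ASV}(v)=\sup_{\sigma_0\in\Sigma_0}\mathsf{ASV}(\sigma_0)(v)$. Gap problem for $\mathsf{VAL}\in\{\mathsf{CSV},\mathsf{ASV}\}$ with gap $\epsilon>0$ and threshold $c\in\mathbb{Q}$: given a game and a vertex $v$, answer Yes if $\mathsf{VAL}(v)>c+\epsilon$, answer No if $\mathsf{VAL}(v)<c-\epsilon$, and never answer or answer arbitrarily otherwise. *)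

theory Defs
  imports Complex_Main "HOL-Library.Nat_Bijection"
begin

datatype player = P0 | P1

record 'v arena =
  verts :: "'v set"
  edges :: "('v \<times> 'v) set"
  owned :: "player \<Rightarrow> 'v set"
  weight :: "player \<Rightarrow> 'v \<times> 'v \<Rightarrow> int"

text \<open>Only the values of \<^term>\<open>weight\<close> on edges are relevant; a player may own no vertex.\<close>

definition is_arena :: "'v arena \<Rightarrow> bool" where
  "is_arena A \<longleftrightarrow>
     finite (verts A) \<and> edges A \<subseteq> verts A \<times> verts A \<and>
     (\<forall>u\<in>verts A. \<exists>u'. (u, u') \<in> edges A) \<and>
     owned A P0 \<union> owned A P1 = verts A \<and> owned A P0 \<inter> owned A P1 = {}"

definition is_play :: "'v arena \<Rightarrow> (nat \<Rightarrow> 'v) \<Rightarrow> bool" where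
  "is_play A \<pi> \<longleftrightarrow> (\<forall>k. (\<pi> k, \<pi> (Suc k)) \<in> edges A)"

definition is_history :: "'v arena \<Rightarrow> 'v list \<Rightarrow> bool" where
  "is_history A h \<longleftrightarrow> (\<exists>\<pi> n. is_play A \<pi> \<and> h = map \<pi> [0..<Suc n])"

definition DS :: "'v arena \<Rightarrow> real \<Rightarrow> player \<Rightarrow> (nat \<Rightarrow> 'v) \<Rightarrow> real" where
  "DS A d i \<pi> = (\<Sum>k. d ^ k * real_of_int (weight A i (\<pi> k, \<pi> (Suc k))))"

text \<open>
  Strategies are total functions on lists. Their values on lists that are not histories ending
  in a vertex of the player are unconstrained and have no influence on outcomes.
\<close>

definition strategies :: "'v arena \<Rightarrow> player \<Rightarrow> ('v list \<Rightarrow> 'v) set" where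
  "strategies A i =
     {\<sigma>. \<forall>h. is_history A h \<and> last h \<in> owned A i \<longrightarrow> (last h, \<sigma> h) \<in> edges A}"

definition follows :: "'v arena \<Rightarrow> player \<Rightarrow> ('v list \<Rightarrow> 'v) \<Rightarrow> (nat \<Rightarrow> 'v) \<Rightarrow> bool" where
  "follows A i \<sigma> \<pi> \<longleftrightarrow> (\<forall>k. \<pi> k \<in> owned A i \<longrightarrow> \<pi> (Suc k) = \<sigma> (map \<pi> [0..<Suc k]))"

definition Out :: "'v arena \<Rightarrow> 'v \<Rightarrow> ('v list \<Rightarrow> 'v) \<Rightarrow> ('v list \<Rightarrow> 'v) \<Rightarrow> nat \<Rightarrow> 'v" where
  "Out A v \<sigma>0 \<sigma>1 =
     (THE \<pi>. is_play A \<pi> \<and> \<pi> 0 = v \<and> follows A P0 \<sigma>0 \<pi> \<and> follows A P1 \<sigma>1 \<pi>)"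

definition BR1 :: "'v arena \<Rightarrow> real \<Rightarrow> ('v list \<Rightarrow> 'v) \<Rightarrow> ('v list \<Rightarrow> 'v) set" where
  "BR1 A d \<sigma>0 =
     {\<sigma>1 \<in> strategies A P1. \<forall>v\<in>verts A. \<forall>\<sigma>1'\<in>strategies A P1.
        DS A d P1 (Out A v \<sigma>0 \<sigma>1) \<ge> DS A d P1 (Out A v \<sigma>0 \<sigma>1')}"

text \<open>
  The suprema and infima below are taken in the reals. For an arena, \<open>0 < d < 1\<close>,
  a strategy of Player 0 and a vertex of the arena they range over nonempty bounded sets:
  best responses exist, and finitely many weights bound all discounted sums.
\<close>

definition CSV_strat :: "'v arena \<Rightarrow> real \<Rightarrow> ('v list \<Rightarrow> 'v) \<Rightarrow> 'v \<Rightarrow> real" where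
  "CSV_strat A d \<sigma>0 v = (SUP \<sigma>1\<in>BR1 A d \<sigma>0. DS A d P0 (Out A v \<sigma>0 \<sigma>1))"

definition CSV :: "'v arena \<Rightarrow> real \<Rightarrow> 'v \<Rightarrow> real" where
  "CSV A d v = (SUP \<sigma>0\<in>strategies A P0. CSV_strat A d \<sigma>0 v)"

definition ASV_strat :: "'v arena \<Rightarrow> real \<Rightarrow> ('v list \<Rightarrow> 'v) \<Rightarrow> 'v \<Rightarrow> real" where
  "ASV_strat A d \<sigma>0 v = (INF \<sigma>1\<in>BR1 A d \<sigma>0. DS A d P0 (Out A v \<sigma>0 \<sigma>1))"

definition ASV :: "'v arena \<Rightarrow> real \<Rightarrow> 'v \<Rightarrow> real" where
  "ASV A d v = (SUP \<sigma>0\<in>strategies A P0. ASV_strat A d \<sigma>0 v)"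

text \<open>
  Algorithms are partial recursive functions, with \<^term>\<open>None\<close> for divergence. Functions of
  several arguments are functions of one argument via the pairing bijection \<^term>\<open>prod_encode\<close>:
  the basic functions are zero, successor and the two projections, and the class is closed under
  pairing, composition, primitive recursion and unbounded minimisation. Minimisation finds the
  least zero, provided that the function is defined at all smaller arguments.
\<close>

inductive partial_recursive :: "(nat \<Rightarrow> nat option) \<Rightarrow> bool" where
  zero: "partial_recursive (\<lambda>n. Some 0)"
| succ: "partial_recursive (\<lambda>n. Some (Suc n))"
| proj1: "partial_recursive (\<lambda>n. Some (fst (prod_decode n)))"
| proj2: "partial_recursive (\<lambda>n. Some (snd (prod_decode n)))"
| pair: "partial_recursive f \<Longrightarrow> partial_recursive g \<Longrightarrow>
    partial_recursive
      (\<lambda>n. Option.bind (f n) (\<lambda>a. Option.bind (g n) (\<lambda>b. Some (prod_encode (a, b)))))"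
| comp: "partial_recursive f \<Longrightarrow> partial_recursive g \<Longrightarrow>
    partial_recursive (\<lambda>n. Option.bind (g n) f)"
| prim_rec: "partial_recursive f \<Longrightarrow> partial_recursive g \<Longrightarrow>
    partial_recursive
      (\<lambda>n. case prod_decode n of (a, k) \<Rightarrow>
         rec_nat (f a)
           (\<lambda>m r. Option.bind r (\<lambda>b. g (prod_encode (a, prod_encode (m, b))))) k)"
| mu: "partial_recursive f \<Longrightarrow>
    partial_recursive
      (\<lambda>a. if \<exists>n. f (prod_encode (a, n)) = Some 0 \<and> (\<forall>m<n. f (prod_encode (a, m)) \<noteq> None)
           then Some (LEAST n. f (prod_encode (a, n)) = Some 0) else None)"

definition rat_encode :: "rat \<Rightarrow> nat" where
  "rat_encode q = (case quotient_of q of (a, b) \<Rightarrow> prod_encode (int_encode a, int_encode b))"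

definition finset_encode :: "nat set \<Rightarrow> nat" where
  "finset_encode S = list_encode (sorted_list_of_set S)"

definition edge_encode :: "nat arena \<Rightarrow> nat \<times> nat \<Rightarrow> nat" where
  "edge_encode A e =
     prod_encode (prod_encode e,
       prod_encode (int_encode (weight A P0 e), int_encode (weight A P1 e)))"

text \<open>The set of vertices is not listed separately: it is the union of the two owned sets.\<close>

definition arena_encode :: "nat arena \<Rightarrow> nat" where
  "arena_encode A =
     list_encode [finset_encode (owned A P0), finset_encode (owned A P1),
       finset_encode (edge_encode A ` edges A)]"

definition instance_encode :: "nat arena \<Rightarrow> rat \<Rightarrow> nat \<Rightarrow> rat \<Rightarrow> rat \<Rightarrow> nat" where
  "instance_encode A d v \<epsilon> c =
     list_encode [arena_encode A, rat_encode d, v, rat_encode \<epsilon>, rat_encode c]"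

abbreviation Yes :: nat where "Yes \<equiv> 1"
abbreviation No :: nat where "No \<equiv> 0"

text \<open>The description in the definition of \<^const>\<open>Out\<close> is well-defined.\<close>

lemma Out_ex1:
  assumes A: "is_arena A" and v: "v \<in> verts A"
    and s0: "\<sigma>0 \<in> strategies A P0" and s1: "\<sigma>1 \<in> strategies A P1"
  shows "\<exists>!\<pi>. is_play A \<pi> \<and> \<pi> 0 = v \<and> follows A P0 \<sigma>0 \<pi> \<and> follows A P1 \<sigma>1 \<pi>"
proof -
  define step where "step h = (if last h \<in> owned A P0 then \<sigma>0 h else \<sigma>1 h)" for h
  define H where "H n = rec_nat [v] (\<lambda>_ h. h @ [step h]) n" for n
  define p where "p n = last (H n)" for n
  have H_simps: "H 0 = [v]" "H (Suc n) = H n @ [step (H n)]" for n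
    by (simp_all add: H_def)
  have H_map: "H n = map p [0..<Suc n]" for n
    by (induction n) (simp_all add: H_simps p_def)
  have p0: "p 0 = v" by (simp add: p_def H_simps)
  have pS: "p (Suc n) = step (H n)" for n by (simp add: p_def H_simps)
  have cover: "u \<in> owned A P0 \<or> u \<in> owned A P1" if "u \<in> verts A" for u
    using A that by (auto simp: is_arena_def)
  have disj: "u \<notin> owned A P1" if "u \<in> owned A P0" for u
    using A that by (auto simp: is_arena_def)
  have tgt: "b \<in> verts A" if "(a, b) \<in> edges A" for a b
    using A that by (auto simp: is_arena_def)
  obtain s where s: "\<And>u. u \<in> verts A \<Longrightarrow> (u, s u) \<in> edges A"
    using A unfolding is_arena_def by metis
  have extend: "is_history A (map p [0..<Suc n])"
    if e: "\<And>k. k < n \<Longrightarrow> (p k, p (Suc k)) \<in> edges A" and pn: "p n \<in> verts A" for n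
  proof -
    define q where "q k = (if k \<le> n then p k else (s ^^ (k - n)) (p n))" for k
    have V: "(s ^^ j) (p n) \<in> verts A" for j
      by (induction j) (use pn s tgt in auto)
    have "(q k, q (Suc k)) \<in> edges A" for k
    proof (cases "k < n")
      case True
      then show ?thesis using e by (simp add: q_def)
    next
      case False
      then have "q k = (s ^^ (k - n)) (p n)" by (auto simp: q_def)
      moreover have "q (Suc k) = s ((s ^^ (k - n)) (p n))"
        using False by (simp add: q_def Suc_diff_le)
      ultimately show ?thesis using s V by simp
    qed
    moreover have "map p [0..<Suc n] = map q [0..<Suc n]"
      by (simp add: q_def)
    ultimately show ?thesis unfolding is_history_def is_play_def by blast
  qed
  have main: "p n \<in> verts A \<and> (\<forall>k<n. (p k, p (Suc k)) \<in> edges A)" for n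
  proof (induction n)
    case 0
    then show ?case using v p0 by simp
  next
    case (Suc n)
    have h: "is_history A (H n)" using extend Suc H_map by metis
    have l: "last (H n) = p n" by (simp add: p_def)
    then have "last (H n) \<in> owned A P0 \<or> last (H n) \<in> owned A P1"
      using Suc cover by simp
    then have "(last (H n), step (H n)) \<in> edges A"
      using s0 s1 h unfolding step_def strategies_def by auto
    then have "(p n, p (Suc n)) \<in> edges A" by (simp only: l pS)
    then show ?case using Suc tgt by (auto simp: less_Suc_eq)
  qed
  have play: "is_play A p" unfolding is_play_def using main by blast
  have f0: "follows A P0 \<sigma>0 p" and f1: "follows A P1 \<sigma>1 p"
    unfolding follows_def pS step_def H_map using disj by (auto simp: last_map)
  have uniq: "q = p"
    if q: "is_play A q" "q 0 = v" "follows A P0 \<sigma>0 q" "follows A P1 \<sigma>1 q" for q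
  proof -
    have qV: "q k \<in> verts A" for k
      using q(1) A unfolding is_play_def is_arena_def by blast
    have "map q [0..<Suc n] = map p [0..<Suc n]" for n
    proof (induction n)
      case 0
      then show ?case using q(2) p0 by simp
    next
      case (Suc n)
      then have qp: "q n = p n" by simp
      have "q (Suc n) = p (Suc n)"
      proof (cases "q n \<in> owned A P0")
        case True
        then show ?thesis using q(3) f0 Suc qp unfolding follows_def by metis
      next
        case False
        then have "q n \<in> owned A P1" using cover qV by blast
        then show ?thesis using q(4) f1 Suc qp unfolding follows_def by metis
      qed
      then show ?case using Suc by simp
    qed
    then have "last (map q [0..<Suc n]) = last (map p [0..<Suc n])" for n by simp
    then show ?thesis by (auto simp: fun_eq_iff)
  qed
  show ?thesis using play p0 f0 f1 uniq by blast
qed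

end

theory Submission
  imports Defs
begin

text \<open>
  A strategy of Player 0 is played faithfully for \<open>N\<close> rounds; after that every history gets either a
  tail on which both players cooperate to maximise the payoff of Player 1, or a tail that punishes
  Player 1. Given an arbitrary strategy, make the tails cooperative after the histories that are
  consistent with best responses and punishing elsewhere (for the cooperative value, cooperate after
  a single such history only). This only raises the payoff of Player 1 along best responses and
  lowers it elsewhere, so no new history of length \<open>N\<close> becomes optimal, while the payoff of Player 0
  moves by at most a multiple of \<open>d ^ N\<close>. Both kinds of tails have rational values, given by Bellman
  equations, so the pairs of payoffs that are achievable with such strategies form a finite set that
  is computed exactly by recursion on \<open>N\<close>; ties between responses are therefore decidable.
\<close>

section \<open>Computable functions on encodable types\<close>

text \<open>The obstacle is that a best response is an exact maximiser: an arbitrarily small error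
  in the payoffs of Player 1 can create or break a tie and so change the payoff of Player 0 by a
  constant amount. Hence only the payoff of Player 0 is approximated; on the tails it is entered as
  0, an error of at most \<open>K * d ^ N\<close> with \<open>K = W / (1 - d)\<close>. For Player 1
  the change caused by truncation has to be one-sided rather than small. The two tails provide this
  because they are extreme: every residual strategy leaves Player 1 at least the zero-sum value and
  at most the cooperative value, and positional strategies attain both.

  The values of the tails, a bound on the weights and the depth are not computed but found by
  unbounded minimisation, as a certificate. Its existence rests on a limit argument, whereas
  checking it takes integer arithmetic only, because every solution of the Bellman equations is the
  value of a tail. Two certificates can lead to different answers only inside the gap, so it does
  not matter which one the search finds.\<close>

definition total_recursive :: "(nat \<Rightarrow> nat) \<Rightarrow> bool" where
  "total_recursive F \<longleftrightarrow> partial_recursive (\<lambda>n. Some (F n))"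

lemma total_recursive_comp:
  assumes "total_recursive F" "total_recursive G"
  shows "total_recursive (\<lambda>n. F (G n))"
  using partial_recursive.comp[of "\<lambda>n. Some (F n)" "\<lambda>n. Some (G n)"] assms
  by (simp add: total_recursive_def)

lemma total_recursive_pair:
  assumes "total_recursive F" "total_recursive G"
  shows "total_recursive (\<lambda>n. prod_encode (F n, G n))"
  using partial_recursive.pair[of "\<lambda>n. Some (F n)" "\<lambda>n. Some (G n)"] assms
  by (simp add: total_recursive_def)

lemma total_recursive_rec_nat:
  assumes "total_recursive F" "total_recursive G"
  shows "total_recursive (\<lambda>n. rec_nat (F (fst (prod_decode n)))
    (\<lambda>m r. G (prod_encode (fst (prod_decode n), prod_encode (m, r)))) (snd (prod_decode n)))"
proof -
  have *: "rec_nat (Some (F a)) (\<lambda>m r. Option.bind r (\<lambda>b. Some (G (prod_encode (a, prod_encode (m, b)))))) k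
    = Some (rec_nat (F a) (\<lambda>m r. G (prod_encode (a, prod_encode (m, r)))) k)" for a k
    by (induction k) simp_all
  show ?thesis
    using partial_recursive.prim_rec[of "\<lambda>n. Some (F n)" "\<lambda>n. Some (G n)"] assms
    by (simp add: total_recursive_def * case_prod_unfold)
qed

lemma total_recursive_const: "total_recursive (\<lambda>_. c)"
proof (induction c)
  case 0
  then show ?case by (simp add: total_recursive_def partial_recursive.zero)
next
  case (Suc c)
  have "total_recursive Suc" by (simp add: total_recursive_def partial_recursive.succ)
  from total_recursive_comp[OF this Suc] show ?case .
qed

lemma total_recursive_id: "total_recursive (\<lambda>n. n)"
  using total_recursive_pair[of "\<lambda>n. fst (prod_decode n)" "\<lambda>n. snd (prod_decode n)"]
  by (simp add: total_recursive_def partial_recursive.proj1 partial_recursive.proj2)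

section \<open>Types with natural-number codes, and computable functions between them\<close>

class encodable =
  fixes enc :: "'a \<Rightarrow> nat"
  assumes inj_enc: "inj enc"

lemma enc_eq_iff: "enc x = enc y \<longleftrightarrow> x = y"
  using inj_enc by (auto dest: injD)

instantiation nat :: encodable
begin
definition "enc (n :: nat) = n"
instance by standard (simp add: enc_nat_def inj_def)
end

instantiation bool :: encodable
begin
definition "enc (b :: bool) = (of_bool b :: nat)"
instance by standard (simp add: enc_bool_def inj_def)
end

instantiation int :: encodable
begin
definition "enc (z :: int) = int_encode z"
instance by standard (simp add: enc_int_def inj_def int_encode_eq)
end

instantiation prod :: (encodable, encodable) encodable
begin
definition "enc p = prod_encode (enc (fst p), enc (snd p))"
instance by standard (auto simp: enc_prod_def inj_def enc_eq_iff)
end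

instantiation list :: (encodable) encodable
begin
definition "enc xs = list_encode (map enc xs)"
instance by standard (auto simp: enc_list_def inj_def list_encode_eq inj_map_eq_map[OF inj_enc])
end

lemma enc_Nil [simp]: "enc [] = 0"
  and enc_Cons [simp]: "enc (x # xs) = Suc (prod_encode (enc x, enc xs))"
  by (simp_all add: enc_list_def)

lemma surj_enc_nat: "surj (enc :: nat \<Rightarrow> nat)"
  by (simp add: enc_nat_def surj_def)

lemma surj_enc_int: "surj (enc :: int \<Rightarrow> nat)"
  using surj_int_encode by (simp add: enc_int_def surj_def)

lemma surj_enc_prod:
  assumes "surj (enc :: 'a::encodable \<Rightarrow> nat)" "surj (enc :: 'b::encodable \<Rightarrow> nat)"
  shows "surj (enc :: 'a \<times> 'b \<Rightarrow> nat)"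
proof (rule surjI)
  fix n
  show "enc (inv enc (fst (prod_decode n)) :: 'a, inv enc (snd (prod_decode n)) :: 'b) = n"
    by (simp add: enc_prod_def surj_f_inv_f assms)
qed

lemma surj_enc_list:
  assumes "surj (enc :: 'a::encodable \<Rightarrow> nat)"
  shows "surj (enc :: 'a list \<Rightarrow> nat)"
proof (rule surjI)
  fix n
  show "enc (map (inv enc :: nat \<Rightarrow> 'a) (list_decode n)) = n"
    by (simp add: enc_list_def o_def surj_f_inv_f assms)
qed

text \<open>The realiser \<open>F\<close> is constrained on codes only and may do anything
  elsewhere. Hence injective codes suffice, even for \<open>bool\<close> with its two codes.\<close>

definition computable :: "('a::encodable \<Rightarrow> 'b::encodable) \<Rightarrow> bool" where
  "computable f \<longleftrightarrow> (\<exists>F. total_recursive F \<and> (\<forall>x. F (enc x) = enc (f x)))"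

named_theorems computable_intros

text \<open>Computability sees only codes, so a function may be traded for one with another result
  type and the same codes. Many proofs below compute a code as a number and then cast it
  back.\<close>

lemma computable_cast:
  assumes "computable f" "\<And>x. enc (g x) = enc (f x)"
  shows "computable g"
  using assms by (simp add: computable_def)

lemma computable_nat_iff: "computable (F :: nat \<Rightarrow> nat) \<longleftrightarrow> total_recursive F"
  by (simp add: computable_def enc_nat_def flip: fun_eq_iff)

lemma computable_id [computable_intros]: "computable (\<lambda>x. x)"
  unfolding computable_def by (rule exI[of _ "\<lambda>n. n"]) (simp add: total_recursive_id)

lemma computable_const [computable_intros]: "computable (\<lambda>_. c)"
  unfolding computable_def by (rule exI[of _ "\<lambda>n. enc c"]) (simp add: total_recursive_const)

lemma computable_comp:
  assumes "computable f" "computable g"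
  shows "computable (\<lambda>x. f (g x))"
proof -
  obtain F G where "total_recursive F" "\<And>x. F (enc x) = enc (f x)"
    "total_recursive G" "\<And>x. G (enc x) = enc (g x)"
    using assms unfolding computable_def by metis
  then show ?thesis
    unfolding computable_def by (intro exI[of _ "\<lambda>n. F (G n)"]) (simp add: total_recursive_comp)
qed

lemma computable_Pair [computable_intros]:
  assumes "computable f" "computable g"
  shows "computable (\<lambda>x. (f x, g x))"
proof -
  obtain F G where "total_recursive F" "\<And>x. F (enc x) = enc (f x)"
    "total_recursive G" "\<And>x. G (enc x) = enc (g x)"
    using assms unfolding computable_def by metis
  then show ?thesis
    unfolding computable_def
    by (intro exI[of _ "\<lambda>n. prod_encode (F n, G n)"]) (simp add: total_recursive_pair enc_prod_def)
qed

lemma computable_fst [computable_intros]: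
  assumes "computable f"
  shows "computable (\<lambda>x. fst (f x))"
proof -
  have "computable (fst :: 'b \<times> 'c \<Rightarrow> 'b)"
    unfolding computable_def
    by (rule exI[of _ "\<lambda>n. fst (prod_decode n)"])
      (simp add: enc_prod_def total_recursive_def partial_recursive.proj1)
  from computable_comp[OF this assms] show ?thesis .
qed

lemma computable_snd [computable_intros]:
  assumes "computable f"
  shows "computable (\<lambda>x. snd (f x))"
proof -
  have "computable (snd :: 'b \<times> 'c \<Rightarrow> 'c)"
    unfolding computable_def
    by (rule exI[of _ "\<lambda>n. snd (prod_decode n)"])
      (simp add: enc_prod_def total_recursive_def partial_recursive.proj2)
  from computable_comp[OF this assms] show ?thesis .
qed

lemma computable_Suc [computable_intros]:
  assumes "computable f"
  shows "computable (\<lambda>x. Suc (f x))"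
proof -
  have "computable Suc"
    by (simp add: computable_nat_iff total_recursive_def partial_recursive.succ)
  from computable_comp[OF this assms] show ?thesis .
qed

text \<open>The parameter \<open>x\<close> travels along as the first component of the argument of
  primitive recursion. The premise on \<open>g\<close> is uncurried because its three arguments
  arrive as one nested pair.\<close>

lemma computable_rec_nat [computable_intros]:
  assumes "computable f" "computable (\<lambda>p. g (fst p) (fst (snd p)) (snd (snd p)))" "computable n"
  shows "computable (\<lambda>x. rec_nat (f x) (g x) (n x))"
proof -
  obtain F G where F: "total_recursive F" "\<And>x. F (enc x) = enc (f x)"
    and G: "total_recursive G" "\<And>p. G (enc p) = enc (g (fst p) (fst (snd p)) (snd (snd p)))"
    using assms unfolding computable_def by metis
  define H where "H n = rec_nat (F (fst (prod_decode n)))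
    (\<lambda>m r. G (prod_encode (fst (prod_decode n), prod_encode (m, r)))) (snd (prod_decode n))" for n
  have "total_recursive H"
    unfolding H_def by (rule total_recursive_rec_nat[OF F(1) G(1)])
  moreover have "H (enc (x, k)) = enc (rec_nat (f x) (g x) k)" for x k
  proof (induction k)
    case 0
    then show ?case by (simp add: H_def enc_prod_def F enc_nat_def)
  next
    case (Suc k)
    have "H (enc (x, Suc k)) = G (prod_encode (enc x, prod_encode (k, H (enc (x, k)))))"
      by (simp add: H_def enc_prod_def enc_nat_def)
    also have "\<dots> = G (enc (x, k, rec_nat (f x) (g x) k))"
      by (simp add: Suc) (simp add: enc_prod_def enc_nat_def)
    finally show ?case by (simp add: G)
  qed
  ultimately have "computable (\<lambda>p. rec_nat (f (fst p)) (g (fst p)) (snd p))"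
    unfolding computable_def by (intro exI[of _ H]) auto
  from computable_comp[OF this computable_Pair[OF computable_id assms(3)]] show ?thesis by simp
qed

lemma computable_of_bool [computable_intros]:
  assumes "computable b" shows "computable (\<lambda>x. of_bool (b x) :: nat)"
  by (rule computable_cast[OF assms]) (simp add: enc_nat_def enc_bool_def)

text \<open>Branching is primitive recursion on the truth value, coded as 0 or 1.\<close>

lemma computable_If [computable_intros]:
  assumes "computable b" "computable f" "computable g"
  shows "computable (\<lambda>x. if b x then f x else g x)"
proof -
  have "computable (\<lambda>x. rec_nat (g x) (\<lambda>_ _. f x) (of_bool (b x)))"
    by (intro computable_intros assms computable_comp[OF assms(2)])
  then show ?thesis by (rule computable_cast) simp
qed

lemma computable_nonzero:
  assumes "computable n" shows "computable (\<lambda>x. (n x :: nat) \<noteq> 0)"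
proof -
  have *: "rec_nat 0 (\<lambda>_ _. 1 :: nat) k = of_bool (k \<noteq> 0)" for k
    by (cases k) simp_all
  have "computable (\<lambda>x. rec_nat 0 (\<lambda>_ _. 1 :: nat) (n x))"
    by (intro computable_intros assms)
  then show ?thesis
    by (rule computable_cast) (simp only: * enc_nat_def enc_bool_def)
qed

lemma computable_Not [computable_intros]:
  assumes "computable b" shows "computable (\<lambda>x. \<not> b x)"
proof -
  have "computable (\<lambda>x. if b x then False else True)"
    by (intro computable_intros assms)
  then show ?thesis by (rule computable_cast) simp
qed

lemma computable_conj [computable_intros]:
  assumes "computable b" "computable c" shows "computable (\<lambda>x. b x \<and> c x)"
proof -
  have "computable (\<lambda>x. if b x then c x else False)"
    by (intro computable_intros assms)
  then show ?thesis by (rule computable_cast) simp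
qed

lemma computable_disj [computable_intros]:
  assumes "computable b" "computable c" shows "computable (\<lambda>x. b x \<or> c x)"
proof -
  have "computable (\<lambda>x. if b x then True else c x)"
    by (intro computable_intros assms)
  then show ?thesis by (rule computable_cast) simp
qed

lemma computable_imp [computable_intros]:
  assumes "computable b" "computable c" shows "computable (\<lambda>x. b x \<longrightarrow> c x)"
proof -
  have "computable (\<lambda>x. if b x then c x else True)"
    by (intro computable_intros assms)
  then show ?thesis by (rule computable_cast) simp
qed

lemma computable_plus_nat [computable_intros]:
  assumes "computable m" "computable n" shows "computable (\<lambda>x. m x + n x :: nat)"
proof -
  have *: "rec_nat a (\<lambda>_. Suc) b = a + b" for a b :: nat
    by (induction b) simp_all
  have "computable (\<lambda>x. rec_nat (m x) (\<lambda>_ r. Suc r) (n x))"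
    by (intro computable_intros assms)
  then show ?thesis by (simp add: *)
qed

lemma computable_minus_nat [computable_intros]:
  assumes "computable m" "computable n" shows "computable (\<lambda>x. m x - n x :: nat)"
proof -
  have pred: "rec_nat 0 (\<lambda>k _. k) b = b - 1" for b :: nat
    by (cases b) simp_all
  have *: "rec_nat a (\<lambda>_ r. rec_nat 0 (\<lambda>k _. k) r) b = a - b" for a b :: nat
    by (induction b) (simp_all add: pred)
  have "computable (\<lambda>x. rec_nat (m x) (\<lambda>_ r. rec_nat 0 (\<lambda>k _. k) r) (n x))"
    by (intro computable_intros assms)
  then show ?thesis by (simp only: *)
qed

lemma computable_times_nat [computable_intros]:
  assumes "computable m" "computable n" shows "computable (\<lambda>x. m x * n x :: nat)"
proof -
  have *: "rec_nat 0 (\<lambda>_ r. r + a) b = a * b" for a b :: nat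
    by (induction b) simp_all
  have "computable (\<lambda>x. rec_nat 0 (\<lambda>_ r. r + m x) (n x))"
    by (intro computable_intros assms computable_comp[OF assms(1)])
  then show ?thesis by (simp only: *)
qed

lemma computable_le_nat [computable_intros]:
  assumes "computable m" "computable n" shows "computable (\<lambda>x. (m x :: nat) \<le> n x)"
proof -
  have "computable (\<lambda>x. \<not> (m x - n x \<noteq> 0))"
    by (intro computable_intros computable_nonzero assms)
  then show ?thesis by (rule computable_cast) simp
qed

text \<open>Codes are injective, so equality on any encodable type reduces to two comparisons of
  numbers.\<close>

lemma computable_eq [computable_intros]:
  assumes "computable f" "computable g" shows "computable (\<lambda>x. f x = g x)"
proof -
  have enc: "computable (\<lambda>x. enc (h x))" if "computable h" for h :: "'a \<Rightarrow> 'b"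
    by (rule computable_cast[OF that]) (simp add: enc_nat_def)
  have "computable (\<lambda>x. enc (f x) \<le> enc (g x) \<and> enc (g x) \<le> enc (f x))"
    by (intro computable_intros enc assms)
  then show ?thesis
    by (rule computable_cast) (simp add: eq_iff enc_eq_iff flip: order.eq_iff)
qed

lemma computable_odd [computable_intros]:
  assumes "computable n" shows "computable (\<lambda>x. odd (n x :: nat))"
proof -
  have *: "rec_nat False (\<lambda>_ r. \<not> r) b = odd b" for b :: nat
    by (induction b) simp_all
  have "computable (\<lambda>x. rec_nat False (\<lambda>_ r. \<not> r) (n x))"
    by (intro computable_intros assms)
  then show ?thesis by (simp only: *)
qed

lemma computable_half [computable_intros]:
  assumes "computable n" shows "computable (\<lambda>x. (n x :: nat) div 2)"
proof -
  have *: "rec_nat 0 (\<lambda>k r. if odd k then Suc r else r) b = b div 2" for b :: nat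
    by (induction b) auto
  have "computable (\<lambda>x. rec_nat 0 (\<lambda>k r. if odd k then Suc r else r) (n x))"
    by (intro computable_intros assms)
  then show ?thesis by (simp only: *)
qed

section \<open>Integer arithmetic on codes\<close>

lemma enc_int_alt: "enc z = (if 0 \<le> z then 2 * nat z else Suc (2 * (nat (- z) - 1)))"
  by (auto simp: enc_int_def int_encode_def sum_encode_def nat_diff_distrib)

lemma computable_nat_of_int [computable_intros]:
  assumes "computable z" shows "computable (\<lambda>x. nat (z x))"
proof -
  have enc: "computable (\<lambda>x. enc (z x))"
    by (rule computable_cast[OF assms]) (simp add: enc_nat_def)
  have "computable (\<lambda>x. if odd (enc (z x)) then 0 else enc (z x) div 2)"
    by (intro computable_intros enc)
  then show ?thesis by (rule computable_cast) (auto simp: enc_int_alt enc_nat_def)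
qed

lemma computable_nat_of_minus:
  assumes "computable z" shows "computable (\<lambda>x. nat (- z x))"
proof -
  have enc: "computable (\<lambda>x. enc (z x))"
    by (rule computable_cast[OF assms]) (simp add: enc_nat_def)
  have "computable (\<lambda>x. if odd (enc (z x)) then Suc (enc (z x) div 2) else 0)"
    by (intro computable_intros enc)
  then show ?thesis by (rule computable_cast) (auto simp: enc_int_alt enc_nat_def)
qed

text \<open>Negation, addition and multiplication of integers are reduced to this case: positive and
  negative parts are combined as naturals, and the difference of two naturals is coded by a case
  distinction on its sign.\<close>

lemma computable_nat_diff:
  assumes "computable m" "computable n" shows "computable (\<lambda>x. int (m x) - int (n x))"
proof -
  have "computable (\<lambda>x. if n x \<le> m x then 2 * (m x - n x) else Suc (2 * (n x - m x - 1)))"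
    by (intro computable_intros assms)
  then show ?thesis
    by (rule computable_cast) (auto simp: enc_int_alt enc_nat_def nat_diff_distrib)
qed

lemma computable_uminus_int [computable_intros]:
  assumes "computable z" shows "computable (\<lambda>x. - z x :: int)"
proof -
  have "computable (\<lambda>x. int (nat (- z x)) - int (nat (z x)))"
    by (intro computable_nat_diff computable_nat_of_minus computable_intros assms)
  then show ?thesis by (rule computable_cast) (auto intro: arg_cong[of _ _ enc])
qed

lemma computable_plus_int [computable_intros]:
  assumes "computable y" "computable z" shows "computable (\<lambda>x. y x + z x :: int)"
proof -
  have "computable (\<lambda>x. int (nat (y x) + nat (z x)) - int (nat (- y x) + nat (- z x)))"
    by (intro computable_nat_diff computable_nat_of_minus computable_intros assms)
  then show ?thesis by (rule computable_cast) (rule arg_cong[of _ _ enc], simp)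
qed

lemma computable_times_int [computable_intros]:
  assumes "computable y" "computable z" shows "computable (\<lambda>x. y x * z x :: int)"
proof -
  have *: "int (nat a * nat b + nat (- a) * nat (- b)) - int (nat a * nat (- b) + nat (- a) * nat b) = a * b"
    for a b :: int
    by (cases "0 \<le> a"; cases "0 \<le> b") auto
  have "computable (\<lambda>x. int (nat (y x) * nat (z x) + nat (- y x) * nat (- z x))
    - int (nat (y x) * nat (- z x) + nat (- y x) * nat (z x)))"
    by (intro computable_nat_diff computable_nat_of_minus computable_intros assms)
  then show ?thesis by (simp only: *)
qed

lemma computable_minus_int [computable_intros]:
  assumes "computable y" "computable z" shows "computable (\<lambda>x. y x - z x :: int)"
  using computable_plus_int[OF assms(1) computable_uminus_int[OF assms(2)]] by simp

lemma computable_power_int [computable_intros]: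
  assumes "computable y" "computable n" shows "computable (\<lambda>x. y x ^ n x :: int)"
proof -
  have *: "rec_nat 1 (\<lambda>_ r. a * r) k = a ^ k" for a :: int and k
    by (induction k) simp_all
  have "computable (\<lambda>x. rec_nat 1 (\<lambda>_ r. y x * r) (n x))"
    by (intro computable_intros assms computable_comp[OF assms(1)])
  then show ?thesis by (simp only: *)
qed

lemma computable_le_int [computable_intros]:
  assumes "computable y" "computable z" shows "computable (\<lambda>x. (y x :: int) \<le> z x)"
proof -
  have "computable (\<lambda>x. nat (y x - z x) \<le> 0)"
    by (intro computable_intros assms)
  then show ?thesis by (rule computable_cast) simp
qed

lemma computable_less_int [computable_intros]:
  assumes "computable y" "computable z" shows "computable (\<lambda>x. (y x :: int) < z x)"
  using computable_Not[OF computable_le_int[OF assms(2,1)]] by (simp add: not_le)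

section \<open>Lists\<close>

lemma computable_Cons [computable_intros]:
  assumes "computable f" "computable xs" shows "computable (\<lambda>x. f x # xs x)"
proof -
  have "computable (\<lambda>x. enc (f x, xs x))"
    by (rule computable_cast[OF computable_Pair[OF assms]]) (simp add: enc_nat_def)
  from computable_Suc[OF this] show ?thesis
    by (rule computable_cast) (simp add: enc_nat_def enc_prod_def)
qed

text \<open>Primitive recursion fixes its number of rounds in advance. The code of a list bounds its
  length and is available without any decoding.\<close>

lemma length_le_enc: "length xs \<le> enc xs"
proof (induction xs)
  case (Cons x xs)
  then show ?case using le_prod_encode_2[of "enc xs" "enc x"] by simp
qed simp

text \<open>A nonempty list is coded as the successor of the pair of the codes of head and tail, so
  one round can split off the head. The list functions below are reduced to this fold.\<close>

lemma computable_foldl [computable_intros]: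
  assumes "computable (\<lambda>p. g (fst p) (fst (snd p)) (snd (snd p)))" "computable s" "computable xs"
  shows "computable (\<lambda>x. foldl (g x) (s x) (xs x))"
proof -
  obtain G where G: "total_recursive G" "\<And>p. G (enc p) = enc (g (fst p) (fst (snd p)) (snd (snd p)))"
    using assms(1) unfolding computable_def by metis
  \<comment> \<open>The state pairs the code of the accumulator with the code of the remaining list.
    The empty list has code 0, and from then on the state is constant, so surplus rounds are
    harmless.\<close>
  define step where "step a q = (if snd q = 0 then q else
    (G (enc (a, fst q, fst (prod_decode (snd q - 1)))), snd (prod_decode (snd q - 1))))"
    for a :: nat and q :: "nat \<times> nat"
  define FL where "FL p = rec_nat (snd p) (\<lambda>_. step (fst p)) (snd (snd p))" for p :: "nat \<times> nat \<times> nat"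
  have enc: "computable (\<lambda>x. enc (f x))" if "computable f" for f :: "'x::encodable \<Rightarrow> 'y::encodable"
    by (rule computable_cast[OF that]) (simp add: enc_nat_def)
  have dec: "computable (\<lambda>x. prod_decode (f x))" if "computable f" for f :: "'x::encodable \<Rightarrow> nat"
    by (rule computable_cast[OF that]) (simp add: enc_nat_def enc_prod_def)
  have G': "computable (\<lambda>x. G (f x))" if "computable f" for f :: "'x::encodable \<Rightarrow> nat"
    by (rule computable_comp[OF _ that]) (simp add: computable_nat_iff G)
  have "computable FL"
    unfolding FL_def step_def by (intro computable_intros enc dec G')
  moreover have state: "rec_nat (enc t, enc ys) (\<lambda>_. step (enc x)) n
      = (enc (foldl (g x) t (take n ys)), enc (drop n ys))" for t ys x n
  proof (induction n)
    case (Suc n)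
    have *: "rec_nat (enc t, enc ys) (\<lambda>_. step (enc x)) (Suc n)
      = step (enc x) (enc (foldl (g x) t (take n ys)), enc (drop n ys))"
      by (simp add: Suc)
    show ?case
    proof (cases "n < length ys")
      case True
      then have "drop n ys = ys ! n # drop (Suc n) ys" by (simp add: Cons_nth_drop_Suc)
      moreover have "enc (enc x, enc (foldl (g x) t (take n ys)), enc (ys ! n))
        = enc (x, foldl (g x) t (take n ys), ys ! n)"
        by (simp add: enc_prod_def enc_nat_def)
      ultimately show ?thesis
        unfolding * using True by (simp add: step_def take_Suc_conv_app_nth G)
    next
      case False
      then show ?thesis unfolding * by (simp add: step_def)
    qed
  qed simp
  have "fst (FL (enc x, enc (s x), enc (xs x))) = enc (foldl (g x) (s x) (xs x))" for x
    by (simp add: FL_def state length_le_enc)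
  moreover have "computable (\<lambda>x. fst (FL (enc x, enc (s x), enc (xs x))))"
    by (intro computable_intros computable_comp[OF \<open>computable FL\<close>] enc assms)
  ultimately have "computable (\<lambda>x. enc (foldl (g x) (s x) (xs x)))" by simp
  then show ?thesis by (rule computable_cast) (simp add: enc_nat_def)
qed

lemma computable_rev [computable_intros]:
  assumes "computable xs" shows "computable (\<lambda>x. rev (xs x))"
proof -
  have *: "foldl (\<lambda>r y. y # r) zs ys = rev ys @ zs" for ys zs :: "'b list"
    by (induction ys arbitrary: zs) simp_all
  have "computable (\<lambda>x. foldl (\<lambda>r y. y # r) [] (xs x))"
    by (intro computable_intros assms)
  then show ?thesis by (simp add: *)
qed

lemma computable_append [computable_intros]:
  assumes "computable xs" "computable ys" shows "computable (\<lambda>x. xs x @ ys x)"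
proof -
  have *: "foldl (\<lambda>r y. y # r) zs us = rev us @ zs" for us zs :: "'b list"
    by (induction us arbitrary: zs) simp_all
  have "computable (\<lambda>x. foldl (\<lambda>r y. y # r) (ys x) (rev (xs x)))"
    by (intro computable_intros assms)
  then show ?thesis by (simp add: *)
qed

lemma computable_map [computable_intros]:
  assumes "computable (\<lambda>p. f (fst p) (snd p))" "computable xs"
  shows "computable (\<lambda>x. map (f x) (xs x))"
proof -
  have *: "foldl (\<lambda>r y. r @ [h y]) zs ys = zs @ map h ys" for h :: "'b \<Rightarrow> 'c" and ys zs
    by (induction ys arbitrary: zs) simp_all
  have "computable (\<lambda>x. foldl (\<lambda>r y. r @ [f x y]) [] (xs x))"
    by (intro computable_intros assms) (rule computable_comp[OF assms(1), of "\<lambda>p. (fst p, snd (snd p))", simplified], intro computable_intros)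
  then show ?thesis by (simp add: *)
qed

lemma computable_filter [computable_intros]:
  assumes "computable (\<lambda>p. f (fst p) (snd p))" "computable xs"
  shows "computable (\<lambda>x. filter (f x) (xs x))"
proof -
  have *: "foldl (\<lambda>r y. if h y then r @ [y] else r) zs ys = zs @ filter h ys" for h :: "'b \<Rightarrow> bool" and ys zs
    by (induction ys arbitrary: zs) simp_all
  have "computable (\<lambda>x. foldl (\<lambda>r y. if f x y then r @ [y] else r) [] (xs x))"
    by (intro computable_intros assms) (rule computable_comp[OF assms(1), of "\<lambda>p. (fst p, snd (snd p))", simplified], intro computable_intros)
  then show ?thesis by (simp add: *)
qed

lemma computable_concat [computable_intros]:
  assumes "computable xs" shows "computable (\<lambda>x. concat (xs x))"
proof -
  have *: "foldl (@) zs ys = zs @ concat ys" for ys and zs :: "'b list"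
    by (induction ys arbitrary: zs) simp_all
  have "computable (\<lambda>x. foldl (@) [] (xs x))"
    by (intro computable_intros assms)
  then show ?thesis by (simp add: *)
qed

lemma computable_list_ex [computable_intros]:
  assumes "computable (\<lambda>p. f (fst p) (snd p))" "computable xs"
  shows "computable (\<lambda>x. list_ex (f x) (xs x))"
proof -
  have *: "list_ex h ys \<longleftrightarrow> filter h ys \<noteq> []" for h :: "'b \<Rightarrow> bool" and ys
    by (auto simp: list_ex_iff filter_empty_conv)
  have "computable (\<lambda>x. filter (f x) (xs x) \<noteq> [])"
    by (intro computable_intros assms)
  then show ?thesis by (simp add: *)
qed

lemma computable_list_all [computable_intros]:
  assumes "computable (\<lambda>p. f (fst p) (snd p))" "computable xs"
  shows "computable (\<lambda>x. list_all (f x) (xs x))"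
proof -
  have *: "list_all h ys \<longleftrightarrow> \<not> list_ex (\<lambda>y. \<not> h y) ys" for h :: "'b \<Rightarrow> bool" and ys
    by (auto simp: list_ex_iff list_all_iff)
  have "computable (\<lambda>x. \<not> list_ex (\<lambda>y. \<not> f x y) (xs x))"
    by (intro computable_intros assms)
  then show ?thesis by (simp add: *)
qed

text \<open>Minimisation searches through the codes of witnesses. By surjectivity every number,
  hence also the least zero, codes some \<open>b\<close>; and as the test is total, the search stops
  once a witness exists. Which witness is found remains open in the conclusion.\<close>

lemma partial_recursive_search:
  fixes P :: "'a::encodable \<Rightarrow> 'b::encodable \<Rightarrow> bool" and h :: "'a \<Rightarrow> 'b \<Rightarrow> 'c::encodable"
  assumes P: "computable (\<lambda>p. P (fst p) (snd p))" and h: "computable (\<lambda>p. h (fst p) (snd p))"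
    and surj: "surj (enc :: 'b \<Rightarrow> nat)"
  obtains f where "partial_recursive f"
    "\<And>a. \<exists>b. P a b \<Longrightarrow> \<exists>b. P a b \<and> f (enc a) = Some (enc (h a b))"
proof -
  have nP: "computable (\<lambda>p. \<not> P (fst p) (snd p))"
    by (intro computable_intros P)
  obtain F where F: "total_recursive F" "\<And>a b. F (enc (a, b)) = of_bool (\<not> P a b)"
    using nP unfolding computable_def enc_bool_def by (metis fst_conv snd_conv)
  obtain H where H: "total_recursive H" "\<And>a b. H (enc (a, b)) = enc (h a b)"
    using h unfolding computable_def by (metis fst_conv snd_conv)
  define m where "m a = (if \<exists>n. Some (F (prod_encode (a, n))) = Some 0 \<and>
      (\<forall>m<n. Some (F (prod_encode (a, m))) \<noteq> None)
    then Some (LEAST n. Some (F (prod_encode (a, n))) = Some 0) else None)" for a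
  define f where "f = (\<lambda>n. Option.bind (Option.bind (Some n) (\<lambda>a. Option.bind (m n) (\<lambda>b. Some (prod_encode (a, b)))))
    (\<lambda>k. Some (H k)))"
  show thesis
  proof
    have "partial_recursive m"
      unfolding m_def by (rule partial_recursive.mu) (use F in \<open>simp add: total_recursive_def\<close>)
    then show "partial_recursive f"
      unfolding f_def using total_recursive_id H(1)
      by (intro partial_recursive.comp[where g = "\<lambda>n. Option.bind (Some n) (\<lambda>a. Option.bind (m n) (\<lambda>b. Some (prod_encode (a, b))))"]
          partial_recursive.pair) (simp_all add: total_recursive_def)
    fix a assume "\<exists>b. P a b"
    then obtain b where b: "P a b" by blast
    define n where "n = (LEAST n. F (prod_encode (enc a, n)) = 0)"
    have F0: "F (prod_encode (enc a, enc b)) = 0"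
      using F(2)[of a b] b by (simp add: enc_prod_def)
    then have "F (prod_encode (enc a, n)) = 0"
      unfolding n_def by (rule LeastI)
    moreover obtain c :: 'b where c: "n = enc c" using surj by (metis surjE)
    ultimately have "P a c" using F(2)[of a c] by (simp add: enc_prod_def split: if_splits)
    moreover have "m (enc a) = Some n"
      using F0 by (auto simp: m_def n_def)
    ultimately show "\<exists>b. P a b \<and> f (enc a) = Some (enc (h a b))"
      using H(2)[of a c] by (intro exI[of _ c]) (simp add: f_def c enc_prod_def)
  qed
qed

section \<open>Best responses\<close>

text \<open>Unfolding the one-step inequality \<open>n\<close> times leaves the remainder
  \<open>d ^ n * F n\<close>, which vanishes because \<open>F\<close> is bounded. In this way local
  inequalities along a play become bounds on its payoff.\<close>

lemma discounted_le_suminf: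
  fixes F w :: "nat \<Rightarrow> real"
  assumes d: "0 < d" "d < 1" and step: "\<And>k. F k \<le> w k + d * F (Suc k)"
    and C: "\<And>k. \<bar>F k\<bar> \<le> C" and sm: "summable (\<lambda>k. d ^ k * w k)"
  shows "F 0 \<le> (\<Sum>k. d ^ k * w k)"
proof -
  have partial: "F 0 \<le> (\<Sum>k<n. d ^ k * w k) + d ^ n * F n" for n
  proof (induction n)
    case (Suc n)
    have "d ^ n * F n \<le> d ^ n * (w n + d * F (Suc n))"
      by (rule mult_left_mono[OF step zero_le_power[OF less_imp_le[OF d(1)]]])
    then have "d ^ n * F n \<le> d ^ n * w n + d ^ Suc n * F (Suc n)"
      by (simp add: distrib_left mult.assoc mult.left_commute)
    moreover have "(\<Sum>k<Suc n. d ^ k * w k) = (\<Sum>k<n. d ^ k * w k) + d ^ n * w n"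
      by (rule sum.lessThan_Suc)
    ultimately show ?case using Suc by linarith
  qed simp
  have "(\<lambda>n. d ^ n * F n) \<longlonglongrightarrow> 0"
  proof (rule tendsto_0_le[where K = 1])
    have "norm (d ^ n * F n) \<le> norm (d ^ n * C) * 1" for n
      using order_trans[OF C[of n] abs_ge_self] d by (simp add: abs_mult mult_left_mono)
    then show "\<forall>\<^sub>F n in sequentially. norm (d ^ n * F n) \<le> norm (d ^ n * C) * 1" by simp
    show "(\<lambda>n. d ^ n * C) \<longlonglongrightarrow> 0"
      using d by (intro tendsto_mult_left_zero LIMSEQ_power_zero) simp
  qed
  then have "(\<lambda>n. (\<Sum>k<n. d ^ k * w k) + d ^ n * F n) \<longlonglongrightarrow> (\<Sum>k. d ^ k * w k) + 0"
    using sm by (intro tendsto_add summable_LIMSEQ)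
  then show ?thesis
    using partial by (metis (no_types, lifting) LIMSEQ_le_const add.right_neutral)
qed

lemma all_nat_split: "(\<forall>k. P k) \<longleftrightarrow> P 0 \<and> (\<forall>k. P (Suc k))"
proof
  assume *: "P 0 \<and> (\<forall>k. P (Suc k))"
  show "\<forall>k. P k"
  proof
    fix k show "P k" using * by (cases k) auto
  qed
qed simp

lemma suminf_le_discounted:
  fixes F w :: "nat \<Rightarrow> real"
  assumes "0 < d" "d < 1" "\<And>k. w k + d * F (Suc k) \<le> F k"
    "\<And>k. \<bar>F k\<bar> \<le> C" "summable (\<lambda>k. d ^ k * w k)"
  shows "(\<Sum>k. d ^ k * w k) \<le> F 0"
proof -
  have "- F k \<le> - w k + d * - F (Suc k)" for k using assms(3)[of k] by simp
  moreover have "summable (\<lambda>k. d ^ k * - w k)" using summable_minus[OF assms(5)] by simp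
  ultimately have "- F 0 \<le> (\<Sum>k. d ^ k * - w k)"
    using assms by (intro discounted_le_suminf[of d "\<lambda>k. - F k" "\<lambda>k. - w k" C]) auto
  then show ?thesis using suminf_minus[OF assms(5)] by simp
qed

section \<open>Plays, payoffs and residual strategies in a fixed game\<close>

locale discounted_game =
  fixes A :: "'v arena" and d W :: real
  assumes arena: "is_arena A" and d_pos: "0 < d" and d_less_1: "d < 1"
    and W: "\<And>i e. e \<in> edges A \<Longrightarrow> \<bar>real_of_int (weight A i e)\<bar> \<le> W"
begin

definition wt :: "player \<Rightarrow> 'v \<Rightarrow> 'v \<Rightarrow> real" where
  "wt i u j = real_of_int (weight A i (u, j))"

abbreviation ds :: "player \<Rightarrow> (nat \<Rightarrow> 'v) \<Rightarrow> real" where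
  "ds \<equiv> DS A d"

definition K :: real where "K = W / (1 - d)"

lemma finite_verts: "finite (verts A)"
  using arena by (simp add: is_arena_def)

lemma edge_verts: "(u, j) \<in> edges A \<Longrightarrow> u \<in> verts A \<and> j \<in> verts A"
  using arena by (auto simp: is_arena_def)

lemma finite_succ: "finite {j. (u, j) \<in> edges A}"
  by (rule finite_subset[OF _ finite_verts]) (use edge_verts in blast)

lemma ex_edge: "u \<in> verts A \<Longrightarrow> \<exists>j. (u, j) \<in> edges A"
  using arena by (auto simp: is_arena_def)

lemma owned_P1_iff: "u \<in> verts A \<Longrightarrow> u \<in> owned A P1 \<longleftrightarrow> u \<notin> owned A P0"
  using arena by (auto simp: is_arena_def)

lemma play_verts: "is_play A \<pi> \<Longrightarrow> \<pi> k \<in> verts A"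
  using edge_verts by (auto simp: is_play_def)

lemma wt_bound: "(u, j) \<in> edges A \<Longrightarrow> \<bar>wt i u j\<bar> \<le> W"
  using W by (simp add: wt_def)

lemma ds_def: "ds i \<pi> = (\<Sum>k. d ^ k * wt i (\<pi> k) (\<pi> (Suc k)))"
  by (simp add: DS_def wt_def)

lemma summable_W: "summable (\<lambda>k. d ^ k * W)"
  using d_pos d_less_1 by (intro summable_mult2 summable_geometric) simp

lemma play_wt_bound:
  assumes "is_play A \<pi>" shows "\<bar>d ^ k * wt i (\<pi> k) (\<pi> (Suc k))\<bar> \<le> d ^ k * W"
  using assms wt_bound d_pos by (simp add: abs_mult mult_left_mono is_play_def)

lemma summable_play:
  assumes "is_play A \<pi>" shows "summable (\<lambda>k. d ^ k * wt i (\<pi> k) (\<pi> (Suc k)))"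
  using play_wt_bound[OF assms] by (intro summable_comparison_test'[OF summable_W, of 0]) simp

lemma ds_bound:
  assumes "is_play A \<pi>" shows "\<bar>ds i \<pi>\<bar> \<le> K"
proof -
  let ?f = "\<lambda>k. d ^ k * wt i (\<pi> k) (\<pi> (Suc k))"
  have sm: "summable (\<lambda>k. \<bar>?f k\<bar>)"
    using play_wt_bound[OF assms] by (intro summable_comparison_test'[OF summable_W, of 0]) simp
  have "\<bar>ds i \<pi>\<bar> \<le> (\<Sum>k. \<bar>?f k\<bar>)"
    unfolding ds_def by (rule summable_rabs[OF sm])
  also have "\<dots> \<le> (\<Sum>k. d ^ k * W)"
    using play_wt_bound[OF assms] by (intro suminf_le sm summable_W)
  also have "\<dots> = K"
    using suminf_mult2[of "\<lambda>k. d ^ k" W] suminf_geometric[of d] summable_geometric[of d] d_pos d_less_1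
    by (simp add: K_def)
  finally show ?thesis .
qed

lemma case_nat_eta: "case_nat (\<pi> 0) (\<lambda>k. \<pi> (Suc k)) = \<pi>"
  by (auto simp: fun_eq_iff split: nat.split)

lemma play_Cons: "is_play A (case_nat u \<pi>) \<longleftrightarrow> (u, \<pi> 0) \<in> edges A \<and> is_play A \<pi>"
  using all_nat_split[of "\<lambda>k. (case_nat u \<pi> k, case_nat u \<pi> (Suc k)) \<in> edges A"]
  by (simp add: is_play_def)

lemma ds_Cons:
  assumes "is_play A (case_nat u \<pi>)"
  shows "ds i (case_nat u \<pi>) = wt i u (\<pi> 0) + d * ds i \<pi>"
proof -
  have "is_play A \<pi>" using assms by (simp add: play_Cons)
  then have "d * ds i \<pi> = (\<Sum>k. d ^ Suc k * wt i (\<pi> k) (\<pi> (Suc k)))"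
    unfolding ds_def by (simp add: suminf_mult[OF summable_play, symmetric] mult.assoc)
  with suminf_split_head[OF summable_play[OF assms, of i]] show ?thesis
    by (simp add: ds_def)
qed

text \<open>
  Unlike \<^const>\<open>strategies\<close>, this set is closed under prepending a vertex to the history, even if
  the result is not a history of the arena.
\<close>

definition total_strategies :: "('v list \<Rightarrow> 'v) set" where
  "total_strategies = {\<sigma>. \<forall>h. h \<noteq> [] \<longrightarrow> last h \<in> verts A \<longrightarrow> (last h, \<sigma> h) \<in> edges A}"

definition consistent :: "('v list \<Rightarrow> 'v) \<Rightarrow> 'v \<Rightarrow> (nat \<Rightarrow> 'v) set" where
  "consistent \<sigma> u = {\<pi>. is_play A \<pi> \<and> \<pi> 0 = u \<and> follows A P0 \<sigma> \<pi>}"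

text \<open>The residual strategy after \<open>u\<close>; it makes recursion on the first move
  possible.\<close>

definition shift :: "('v list \<Rightarrow> 'v) \<Rightarrow> 'v \<Rightarrow> 'v list \<Rightarrow> 'v" where
  "shift \<sigma> u h = \<sigma> (u # h)"

definition allowed :: "('v list \<Rightarrow> 'v) \<Rightarrow> 'v \<Rightarrow> 'v set" where
  "allowed \<sigma> u = {j. (u, j) \<in> edges A \<and> (u \<in> owned A P0 \<longrightarrow> j = \<sigma> [u])}"

definition best_value :: "('v list \<Rightarrow> 'v) \<Rightarrow> 'v \<Rightarrow> real" where
  "best_value \<sigma> u = (SUP \<pi>\<in>consistent \<sigma> u. ds P1 \<pi>)"

text \<open>Best responses are represented by the optimal plays that they induce from a single
  vertex; \<open>Out_BR1\<close> justifies this.\<close>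

definition bests :: "('v list \<Rightarrow> 'v) \<Rightarrow> 'v \<Rightarrow> (nat \<Rightarrow> 'v) set" where
  "bests \<sigma> u = {\<pi> \<in> consistent \<sigma> u. ds P1 \<pi> = best_value \<sigma> u}"

lemma is_history_play: "is_play A \<pi> \<Longrightarrow> is_history A (map \<pi> [0..<Suc k])"
  by (auto simp: is_history_def)

lemma is_history_not_Nil: "is_history A h \<Longrightarrow> h \<noteq> []"
  by (auto simp: is_history_def)

lemma total_strategies_subset: "total_strategies \<subseteq> strategies A i"
proof -
  have "owned A i \<subseteq> verts A" using arena by (cases i) (auto simp: is_arena_def)
  then show ?thesis
    using is_history_not_Nil by (auto simp: total_strategies_def strategies_def)
qed

lemma consistent_cong:
  assumes "\<And>h. is_history A h \<Longrightarrow> hd h = u \<Longrightarrow> last h \<in> owned A P0 \<Longrightarrow> \<sigma> h = \<tau> h"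
  shows "consistent \<sigma> u = consistent \<tau> u"
proof -
  have "\<sigma> (map \<pi> [0..<Suc k]) = \<tau> (map \<pi> [0..<Suc k])"
    if "is_play A \<pi>" "\<pi> 0 = u" "\<pi> k \<in> owned A P0" for \<pi> k
    using that by (intro assms is_history_play) (auto simp: hd_map hd_append last_map)
  then show ?thesis
    unfolding consistent_def follows_def by (intro Collect_cong) metis
qed

lemma best_value_cong: "consistent \<sigma> u = consistent \<tau> u \<Longrightarrow> best_value \<sigma> u = best_value \<tau> u"
  by (simp add: best_value_def)

lemma bests_cong: "consistent \<sigma> u = consistent \<tau> u \<Longrightarrow> bests \<sigma> u = bests \<tau> u"
  by (simp add: bests_def best_value_def)

text \<open>Consistency depends only on histories that end in a vertex of Player 0. On all other
  lists the strategy can be redirected along an arbitrary edge.\<close>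

lemma ex_total_strategy:
  assumes "\<sigma> \<in> strategies A P0"
  obtains \<tau> where "\<tau> \<in> total_strategies" "\<And>u. consistent \<tau> u = consistent \<sigma> u"
proof -
  obtain s where s: "\<And>u. u \<in> verts A \<Longrightarrow> (u, s u) \<in> edges A"
    using ex_edge by metis
  define \<tau> where "\<tau> h = (if is_history A h \<and> last h \<in> owned A P0 then \<sigma> h else s (last h))" for h
  show thesis
  proof
    show "\<tau> \<in> total_strategies"
      using assms s by (auto simp: total_strategies_def \<tau>_def strategies_def)
    show "consistent \<tau> u = consistent \<sigma> u" for u
      by (rule consistent_cong) (simp add: \<tau>_def)
  qed
qed

lemma total_strategiesD:
  "\<sigma> \<in> total_strategies \<Longrightarrow> h \<noteq> [] \<Longrightarrow> last h \<in> verts A \<Longrightarrow> (last h, \<sigma> h) \<in> edges A"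
  by (simp add: total_strategies_def)

lemma shift_total:
  assumes "\<sigma> \<in> total_strategies" shows "shift \<sigma> u \<in> total_strategies"
proof -
  have "(last h, \<sigma> (u # h)) \<in> edges A" if "h \<noteq> []" "last h \<in> verts A" for h
    using total_strategiesD[OF assms, of "u # h"] that by simp
  then show ?thesis by (simp add: total_strategies_def shift_def)
qed

lemma allowed_edge: "j \<in> allowed \<sigma> u \<Longrightarrow> (u, j) \<in> edges A"
  by (simp add: allowed_def)

lemma finite_allowed: "finite (allowed \<sigma> u)"
  by (rule finite_subset[OF _ finite_succ[of u]]) (auto simp: allowed_def)

lemma allowed_nonempty:
  assumes "\<sigma> \<in> total_strategies" "u \<in> verts A" shows "allowed \<sigma> u \<noteq> {}"
proof (cases "u \<in> owned A P0")
  case True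
  then show ?thesis
    using total_strategiesD[OF assms(1), of "[u]"] assms(2) by (auto simp: allowed_def)
next
  case False
  then show ?thesis using ex_edge[OF assms(2)] by (auto simp: allowed_def)
qed

lemma consistent_play: "\<pi> \<in> consistent \<sigma> u \<Longrightarrow> is_play A \<pi>"
  by (simp add: consistent_def)

lemma consistent_0: "\<pi> \<in> consistent \<sigma> u \<Longrightarrow> \<pi> 0 = u"
  by (simp add: consistent_def)

lemma map_case_nat: "map (case_nat u \<pi>) [0..<Suc (Suc k)] = u # map \<pi> [0..<Suc k]"
  by (subst upt_conv_Cons) (simp_all add: map_Suc_upt[symmetric] del: upt_Suc)

lemma follows_Cons:
  "follows A P0 \<sigma> (case_nat u \<pi>) \<longleftrightarrow>
    (u \<in> owned A P0 \<longrightarrow> \<pi> 0 = \<sigma> [u]) \<and> follows A P0 (shift \<sigma> u) \<pi>"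
proof -
  have "map (case_nat u \<pi>) [0..<Suc 0] = [u]" by simp
  then show ?thesis
    using all_nat_split[of "\<lambda>k. case_nat u \<pi> k \<in> owned A P0 \<longrightarrow>
      case_nat u \<pi> (Suc k) = \<sigma> (map (case_nat u \<pi>) [0..<Suc k])"]
    unfolding follows_def map_case_nat shift_def by (simp del: upt_Suc)
qed

lemma consistent_Cons:
  "case_nat u \<pi> \<in> consistent \<sigma> u \<longleftrightarrow> \<pi> 0 \<in> allowed \<sigma> u \<and> \<pi> \<in> consistent (shift \<sigma> u) (\<pi> 0)"
  by (auto simp: consistent_def play_Cons follows_Cons allowed_def)

lemma consistent_cases:
  assumes "\<pi> \<in> consistent \<sigma> u"
  obtains \<rho> where "\<pi> = case_nat u \<rho>" "\<rho> 0 \<in> allowed \<sigma> u" "\<rho> \<in> consistent (shift \<sigma> u) (\<rho> 0)"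
proof
  show eq: "\<pi> = case_nat u (\<lambda>k. \<pi> (Suc k))"
    using case_nat_eta[of \<pi>] assms by (simp add: consistent_def)
  show "(\<lambda>k. \<pi> (Suc k)) 0 \<in> allowed \<sigma> u"
    "(\<lambda>k. \<pi> (Suc k)) \<in> consistent (shift \<sigma> u) ((\<lambda>k. \<pi> (Suc k)) 0)"
    using assms eq consistent_Cons by metis+
qed

text \<open>Player 1 answers positionally with \<open>s\<close>. An arbitrary \<open>s\<close> shows
  that consistent plays exist; an optimal \<open>s\<close> yields lower bounds on
  \<open>best_value\<close>.\<close>

lemma ex_consistent_against:
  assumes \<sigma>: "\<sigma> \<in> total_strategies" and u: "u \<in> verts A"
    and s: "\<And>u. u \<in> verts A \<Longrightarrow> (u, s u) \<in> edges A"
  obtains \<pi> where "\<pi> \<in> consistent \<sigma> u" "\<And>k. \<pi> k \<notin> owned A P0 \<Longrightarrow> \<pi> (Suc k) = s (\<pi> k)"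
proof -
  define \<tau> where "\<tau> h = s (last h)" for h
  have "\<tau> \<in> total_strategies" using s by (simp add: total_strategies_def \<tau>_def)
  then obtain \<pi> where \<pi>: "is_play A \<pi>" "\<pi> 0 = u" "follows A P0 \<sigma> \<pi>" "follows A P1 \<tau> \<pi>"
    using Out_ex1[OF arena u] \<sigma> total_strategies_subset by blast
  show thesis
  proof
    show "\<pi> \<in> consistent \<sigma> u" using \<pi> by (simp add: consistent_def)
    fix k assume "\<pi> k \<notin> owned A P0"
    then have "\<pi> k \<in> owned A P1" using owned_P1_iff play_verts[OF \<pi>(1)] by blast
    then show "\<pi> (Suc k) = s (\<pi> k)"
      using \<pi>(4) by (simp add: follows_def \<tau>_def last_map)
  qed
qed

lemma consistent_nonempty:
  assumes "\<sigma> \<in> total_strategies" "u \<in> verts A" shows "consistent \<sigma> u \<noteq> {}"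
  using ex_consistent_against[OF assms] ex_edge by (metis empty_iff)

section \<open>Bellman equation and optimal plays against a fixed strategy of Player 0\<close>

lemma ds_le_best_value:
  assumes "\<pi> \<in> consistent \<sigma> u" shows "ds P1 \<pi> \<le> best_value \<sigma> u"
  unfolding best_value_def
proof (rule cSUP_upper[OF assms])
  show "bdd_above (ds P1 ` consistent \<sigma> u)"
    using ds_bound consistent_play by (intro bdd_aboveI2[of _ _ K]) (simp add: abs_le_iff)
qed

lemma best_value_le:
  assumes "\<sigma> \<in> total_strategies" "u \<in> verts A" "\<And>\<pi>. \<pi> \<in> consistent \<sigma> u \<Longrightarrow> ds P1 \<pi> \<le> c"
  shows "best_value \<sigma> u \<le> c"
  unfolding best_value_def using assms consistent_nonempty by (intro cSUP_least) auto

lemma best_value_bound: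
  assumes "\<sigma> \<in> total_strategies" "u \<in> verts A" shows "\<bar>best_value \<sigma> u\<bar> \<le> K"
proof -
  obtain \<pi> where \<pi>: "\<pi> \<in> consistent \<sigma> u" using consistent_nonempty[OF assms] by blast
  have "best_value \<sigma> u \<le> K"
    using ds_bound[OF consistent_play] by (intro best_value_le assms) (simp add: abs_le_iff)
  moreover have "- K \<le> ds P1 \<pi>" using ds_bound[OF consistent_play[OF \<pi>], of P1] by (simp add: abs_le_iff)
  ultimately show ?thesis using ds_le_best_value[OF \<pi>] by linarith
qed

lemma best_value_ge_succ:
  assumes \<sigma>: "\<sigma> \<in> total_strategies" and j: "j \<in> allowed \<sigma> u"
  shows "wt P1 u j + d * best_value (shift \<sigma> u) j \<le> best_value \<sigma> u"
proof -
  have "best_value (shift \<sigma> u) j \<le> (best_value \<sigma> u - wt P1 u j) / d"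
  proof (rule best_value_le[OF shift_total[OF \<sigma>]])
    show "j \<in> verts A" using allowed_edge[OF j] edge_verts by blast
    fix \<pi> assume \<pi>: "\<pi> \<in> consistent (shift \<sigma> u) j"
    then have c: "case_nat u \<pi> \<in> consistent \<sigma> u"
      using j consistent_0[OF \<pi>] by (simp add: consistent_Cons)
    from ds_le_best_value[OF c] ds_Cons[OF consistent_play[OF c], of P1] consistent_0[OF \<pi>]
    show "ds P1 \<pi> \<le> (best_value \<sigma> u - wt P1 u j) / d"
      using d_pos by (simp add: field_simps)
  qed
  then show ?thesis using d_pos by (simp add: field_simps)
qed

text \<open>Together with \<open>best_value_ge_succ\<close> this is the Bellman equation of the
  one-player game that remains for Player 1 once \<open>\<sigma>\<close> is fixed. The maximum
  ranges over finitely many successors and is therefore attained.\<close>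

lemma best_value_attained:
  assumes \<sigma>: "\<sigma> \<in> total_strategies" and u: "u \<in> verts A"
  obtains j where "j \<in> allowed \<sigma> u" "best_value \<sigma> u = wt P1 u j + d * best_value (shift \<sigma> u) j"
proof -
  define f where "f j = wt P1 u j + d * best_value (shift \<sigma> u) j" for j
  have fin: "finite (f ` allowed \<sigma> u)" and ne: "f ` allowed \<sigma> u \<noteq> {}"
    using finite_allowed allowed_nonempty[OF \<sigma> u] by auto
  have "best_value \<sigma> u \<le> Max (f ` allowed \<sigma> u)"
  proof (rule best_value_le[OF \<sigma> u])
    fix \<pi> assume \<pi>: "\<pi> \<in> consistent \<sigma> u"
    then obtain \<rho> where \<rho>: "\<pi> = case_nat u \<rho>" "\<rho> 0 \<in> allowed \<sigma> u" "\<rho> \<in> consistent (shift \<sigma> u) (\<rho> 0)"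
      by (rule consistent_cases)
    have "ds P1 \<pi> = wt P1 u (\<rho> 0) + d * ds P1 \<rho>"
      using ds_Cons consistent_play[OF \<pi>] \<rho>(1) by simp
    also have "\<dots> \<le> f (\<rho> 0)"
      using ds_le_best_value[OF \<rho>(3)] d_pos by (simp add: f_def)
    also have "\<dots> \<le> Max (f ` allowed \<sigma> u)"
      using fin \<rho>(2) by simp
    finally show "ds P1 \<pi> \<le> Max (f ` allowed \<sigma> u)" .
  qed
  moreover obtain j where j: "j \<in> allowed \<sigma> u" "f j = Max (f ` allowed \<sigma> u)"
    using Max_in[OF fin ne] by auto
  ultimately show thesis
    using best_value_ge_succ[OF \<sigma> j(1)] that[OF j(1)] by (simp add: f_def)
qed

text \<open>The supremum over plays is attained by a greedy play, which always moves to a successor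
  attaining the Bellman equation. Along it every one-step inequality is an equality, and discounting
  removes the remainder.\<close>

lemma bests_nonempty:
  assumes \<sigma>: "\<sigma> \<in> total_strategies" and u: "u \<in> verts A"
  shows "bests \<sigma> u \<noteq> {}"
proof -
  define good where "good q j \<longleftrightarrow> j \<in> allowed (fst q) (snd q) \<and>
    best_value (fst q) (snd q) = wt P1 (snd q) j + d * best_value (shift (fst q) (snd q)) j" for q j
  \<comment> \<open>The state consists of the residual strategy and the current vertex, since the
    best value depends on both.\<close>
  define nxt where "nxt q = (shift (fst q) (snd q), SOME j. good q j)" for q
  define st where "st k = (nxt ^^ k) (\<sigma>, u)" for k
  define \<pi> where "\<pi> k = snd (st k)" for k
  have st: "st 0 = (\<sigma>, u)" "st (Suc k) = nxt (st k)" for k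
    by (simp_all add: st_def)
  have inv: "fst (st k) \<in> total_strategies \<and> \<pi> k \<in> verts A" for k
  proof (induction k)
    case (Suc k)
    then have "\<exists>j. good (st k) j"
      unfolding good_def \<pi>_def by (metis best_value_attained)
    then have "good (st k) (snd (st (Suc k)))"
      unfolding st nxt_def by (metis snd_conv someI)
    then have "(\<pi> k, \<pi> (Suc k)) \<in> edges A" by (simp add: good_def allowed_def \<pi>_def)
    with Suc show ?case using edge_verts by (auto simp: st nxt_def shift_total)
  qed (simp add: st \<pi>_def \<sigma> u)
  have good: "good (st k) (\<pi> (Suc k))" for k
  proof -
    have "\<exists>j. good (st k) j"
      using inv[of k] unfolding good_def \<pi>_def by (metis best_value_attained)
    then show ?thesis unfolding \<pi>_def st nxt_def by (metis snd_conv someI)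
  qed
  \<comment> \<open>After \<open>k\<close> moves the residual strategy is \<open>\<sigma>\<close>
    with the first \<open>k\<close> vertices prepended, so obeying it in each state amounts to
    following \<open>\<sigma>\<close>.\<close>
  have fst_st: "fst (st k) h = \<sigma> (map \<pi> [0..<k] @ h)" for k h
    by (induction k arbitrary: h) (simp_all add: st nxt_def shift_def flip: \<pi>_def)
  have play: "is_play A \<pi>"
    using good by (auto simp: is_play_def good_def allowed_def \<pi>_def)
  have "follows A P0 \<sigma> \<pi>"
    using good fst_st by (auto simp: follows_def good_def allowed_def simp flip: \<pi>_def)
  with play have cons: "\<pi> \<in> consistent \<sigma> u" by (simp add: consistent_def \<pi>_def st)
  have "best_value (fst (st 0)) (\<pi> 0) \<le> ds P1 \<pi>"
    unfolding ds_def
  proof (rule discounted_le_suminf[OF d_pos d_less_1, where F = "\<lambda>k. best_value (fst (st k)) (\<pi> k)"])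
    show "best_value (fst (st k)) (\<pi> k)
      \<le> wt P1 (\<pi> k) (\<pi> (Suc k)) + d * best_value (fst (st (Suc k))) (\<pi> (Suc k))" for k
      using good[of k] by (simp add: good_def st nxt_def flip: \<pi>_def)
    show "\<bar>best_value (fst (st k)) (\<pi> k)\<bar> \<le> K" for k
      using best_value_bound inv by blast
  qed (rule summable_play[OF play])
  then have "ds P1 \<pi> = best_value \<sigma> u"
    using ds_le_best_value[OF cons] by (simp add: st \<pi>_def)
  with cons show ?thesis by (auto simp: bests_def)
qed

text \<open>The payoff of a play is at most its first weight plus the discounted best value of the
  rest, which in turn is at most the best value of \<open>u\<close>. The play is best exactly when
  both bounds are tight.\<close>

lemma bests_Cons:
  assumes \<sigma>: "\<sigma> \<in> total_strategies"
  shows "case_nat u \<pi> \<in> bests \<sigma> u \<longleftrightarrow> \<pi> 0 \<in> allowed \<sigma> u \<and> \<pi> \<in> bests (shift \<sigma> u) (\<pi> 0) \<and>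
    wt P1 u (\<pi> 0) + d * best_value (shift \<sigma> u) (\<pi> 0) = best_value \<sigma> u"
proof (cases "\<pi> 0 \<in> allowed \<sigma> u \<and> \<pi> \<in> consistent (shift \<sigma> u) (\<pi> 0)")
  case True
  then have c: "case_nat u \<pi> \<in> consistent \<sigma> u" by (simp add: consistent_Cons)
  have "ds P1 (case_nat u \<pi>) = wt P1 u (\<pi> 0) + d * ds P1 \<pi>"
    by (rule ds_Cons[OF consistent_play[OF c]])
  moreover have "d * ds P1 \<pi> \<le> d * best_value (shift \<sigma> u) (\<pi> 0)"
    using ds_le_best_value True d_pos by simp
  moreover have "wt P1 u (\<pi> 0) + d * best_value (shift \<sigma> u) (\<pi> 0) \<le> best_value \<sigma> u"
    using best_value_ge_succ[OF \<sigma>] True by blast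
  ultimately have "ds P1 (case_nat u \<pi>) = best_value \<sigma> u \<longleftrightarrow>
      d * ds P1 \<pi> = d * best_value (shift \<sigma> u) (\<pi> 0) \<and>
      wt P1 u (\<pi> 0) + d * best_value (shift \<sigma> u) (\<pi> 0) = best_value \<sigma> u"
    by linarith
  with True c d_pos show ?thesis unfolding bests_def by auto
next
  case False
  then show ?thesis by (auto simp: bests_def consistent_Cons)
qed

lemma bests_cases:
  assumes \<sigma>: "\<sigma> \<in> total_strategies" and \<pi>: "\<pi> \<in> bests \<sigma> u"
  obtains \<rho> where "\<pi> = case_nat u \<rho>" "\<rho> 0 \<in> allowed \<sigma> u" "\<rho> \<in> bests (shift \<sigma> u) (\<rho> 0)"
    "wt P1 u (\<rho> 0) + d * best_value (shift \<sigma> u) (\<rho> 0) = best_value \<sigma> u"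
    "ds P0 \<pi> = wt P0 u (\<rho> 0) + d * ds P0 \<rho>"
proof -
  have c: "\<pi> \<in> consistent \<sigma> u" using \<pi> by (simp add: bests_def)
  then obtain \<rho> where \<rho>: "\<pi> = case_nat u \<rho>" by (rule consistent_cases)
  show thesis
  proof (rule that[OF \<rho>])
    show "ds P0 \<pi> = wt P0 u (\<rho> 0) + d * ds P0 \<rho>"
      using ds_Cons consistent_play[OF c] \<rho> by simp
  qed (use \<pi> \<rho> bests_Cons[OF \<sigma>, of u \<rho>] in auto)
qed

text \<open>Threshold form of the value of a strategy: quantifiers over best plays replace infimum
  and supremum, which keeps limits out of the inductions.\<close>

definition good :: "bool \<Rightarrow> ('v list \<Rightarrow> 'v) \<Rightarrow> 'v \<Rightarrow> real \<Rightarrow> bool" where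
  "good adv \<sigma> u t \<longleftrightarrow>
    (if adv then \<forall>\<pi>\<in>bests \<sigma> u. t \<le> ds P0 \<pi> else \<exists>\<pi>\<in>bests \<sigma> u. t \<le> ds P0 \<pi>)"

lemma good_cong: "consistent \<sigma> u = consistent \<tau> u \<Longrightarrow> good adv \<sigma> u t = good adv \<tau> u t"
  by (simp add: good_def bests_def best_value_def)

lemma bests_play: "\<pi> \<in> bests \<sigma> u \<Longrightarrow> is_play A \<pi>"
  by (simp add: bests_def consistent_def)

lemma good_minus_K:
  assumes "\<sigma> \<in> total_strategies" "u \<in> verts A" shows "good adv \<sigma> u (- K)"
proof -
  have "- K \<le> ds P0 \<pi>" if "\<pi> \<in> bests \<sigma> u" for \<pi>
    using ds_bound[OF bests_play[OF that], of P0] by (simp add: abs_le_iff)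
  then show ?thesis using bests_nonempty[OF assms] by (auto simp: good_def)
qed

section \<open>From best-response strategies to best plays\<close>

lemma Out_consistent:
  assumes "\<sigma>0 \<in> strategies A P0" "\<sigma>1 \<in> strategies A P1" "u \<in> verts A"
  shows "Out A u \<sigma>0 \<sigma>1 \<in> consistent \<sigma>0 u"
  using theI'[OF Out_ex1[OF arena assms(3,1,2)]] by (simp add: consistent_def Out_def)

text \<open>Best responses are optimal from all vertices at once, so plays chosen for each starting
  vertex have to be merged into one strategy. They do not interfere, because a history reveals its
  starting vertex.\<close>

lemma ex_strategy_following:
  assumes \<sigma>0: "\<sigma>0 \<in> strategies A P0" and p: "\<And>u. u \<in> verts A \<Longrightarrow> p u \<in> consistent \<sigma>0 u"
  obtains \<sigma>1 where "\<sigma>1 \<in> strategies A P1" "\<And>u. u \<in> verts A \<Longrightarrow> Out A u \<sigma>0 \<sigma>1 = p u"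
proof -
  obtain s where s: "\<And>u. u \<in> verts A \<Longrightarrow> (u, s u) \<in> edges A"
    using ex_edge by metis
  define \<sigma>1 where "\<sigma>1 h = (if hd h \<in> verts A \<and> h = map (p (hd h)) [0..<length h]
    then p (hd h) (length h) else s (last h))" for h
  have on: "\<sigma>1 (map (p u) [0..<Suc k]) = p u (Suc k)" if "u \<in> verts A" for u k
    using that consistent_0[OF p[OF that]] by (simp add: \<sigma>1_def hd_append hd_map del: upt_Suc)
  have "\<sigma>1 \<in> total_strategies"
    unfolding total_strategies_def
  proof (intro CollectI allI impI)
    fix h assume h: "h \<noteq> []" "last h \<in> verts A"
    show "(last h, \<sigma>1 h) \<in> edges A"
    proof (cases "hd h \<in> verts A \<and> h = map (p (hd h)) [0..<length h]")
      case True
      obtain k where k: "length h = Suc k" using h(1) by (cases h) auto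
      then have "last h = p (hd h) k" using True by (metis diff_Suc_1 h(1) last_conv_nth lessI nth_map_upt add_0 diff_zero)
      moreover have "is_play A (p (hd h))" using True p consistent_play by blast
      ultimately show ?thesis using True k by (simp add: \<sigma>1_def is_play_def)
    next
      case False
      then have "\<sigma>1 h = s (last h)" unfolding \<sigma>1_def by (rule if_not_P)
      then show ?thesis using s[OF h(2)] by simp
    qed
  qed
  then have \<sigma>1: "\<sigma>1 \<in> strategies A P1" using total_strategies_subset by blast
  show thesis
  proof (rule that[OF \<sigma>1])
    fix u assume u: "u \<in> verts A"
    have "is_play A (p u)" "p u 0 = u" "follows A P0 \<sigma>0 (p u)"
      using p[OF u] by (auto simp: consistent_def)
    moreover have "follows A P1 \<sigma>1 (p u)" by (simp add: follows_def on[OF u] del: upt_Suc)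
    ultimately show "Out A u \<sigma>0 \<sigma>1 = p u"
      unfolding Out_def using the1_equality[OF Out_ex1[OF arena u \<sigma>0 \<sigma>1]] by blast
  qed
qed

text \<open>\<open>BR1\<close> demands optimality from every vertex. The demands for different
  starting vertices are independent, so the outcomes from \<open>v\<close> are precisely the plays
  that are best from \<open>v\<close>.\<close>

lemma Out_BR1:
  assumes \<sigma>0: "\<sigma>0 \<in> strategies A P0" and v: "v \<in> verts A"
  shows "(\<lambda>\<sigma>1. Out A v \<sigma>0 \<sigma>1) ` BR1 A d \<sigma>0 = bests \<sigma>0 v"
proof -
  obtain \<tau> where \<tau>: "\<tau> \<in> total_strategies" "\<And>u. consistent \<tau> u = consistent \<sigma>0 u"
    using ex_total_strategy[OF \<sigma>0] by blast
  have best_value: "best_value \<sigma>0 u \<le> c"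
    if "u \<in> verts A" "\<And>\<pi>. \<pi> \<in> consistent \<sigma>0 u \<Longrightarrow> ds P1 \<pi> \<le> c" for u c
    using best_value_le[OF \<tau>(1) that(1)] best_value_cong[OF \<tau>(2)] \<tau>(2) that(2) by simp
  have ne: "bests \<sigma>0 u \<noteq> {}" if "u \<in> verts A" for u
    using bests_nonempty[OF \<tau>(1) that] bests_cong[OF \<tau>(2)] by simp
  show ?thesis
  proof (intro equalityI subsetI)
    fix \<pi> assume "\<pi> \<in> (\<lambda>\<sigma>1. Out A v \<sigma>0 \<sigma>1) ` BR1 A d \<sigma>0"
    then obtain \<sigma>1 where \<sigma>1: "\<sigma>1 \<in> BR1 A d \<sigma>0" and \<pi>: "\<pi> = Out A v \<sigma>0 \<sigma>1" by blast
    have c: "\<pi> \<in> consistent \<sigma>0 v"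
      using Out_consistent[OF \<sigma>0 _ v] \<sigma>1 \<pi> by (simp add: BR1_def)
    have "best_value \<sigma>0 v \<le> ds P1 \<pi>"
    proof (rule best_value[OF v])
      fix \<rho> assume \<rho>: "\<rho> \<in> consistent \<sigma>0 v"
      \<comment> \<open>The competitor deviates to \<open>\<rho>\<close> from \<open>v\<close>; the
        best plays from the other vertices merely complete it to a strategy.\<close>
      define p where "p u = (if u = v then \<rho> else SOME q. q \<in> bests \<sigma>0 u)" for u
      have "p u \<in> consistent \<sigma>0 u" if "u \<in> verts A" for u
        using \<rho> some_in_eq[of "bests \<sigma>0 u"] ne[OF that] by (auto simp: p_def bests_def)
      then obtain \<sigma>1' where "\<sigma>1' \<in> strategies A P1" "Out A v \<sigma>0 \<sigma>1' = p v"
        using ex_strategy_following[OF \<sigma>0] v by metis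
      then show "ds P1 \<rho> \<le> ds P1 \<pi>"
        using \<sigma>1 v \<pi> by (auto simp: BR1_def p_def)
    qed
    with ds_le_best_value[OF c] c show "\<pi> \<in> bests \<sigma>0 v" by (simp add: bests_def)
  next
    fix \<pi> assume \<pi>: "\<pi> \<in> bests \<sigma>0 v"
    \<comment> \<open>Here the best plays from the other vertices make the response optimal
      everywhere, as \<open>BR1\<close> requires.\<close>
    define p where "p u = (if u = v then \<pi> else SOME q. q \<in> bests \<sigma>0 u)" for u
    have p: "p u \<in> bests \<sigma>0 u" if "u \<in> verts A" for u
      using \<pi> some_in_eq[of "bests \<sigma>0 u"] ne[OF that] by (auto simp: p_def)
    then have "p u \<in> consistent \<sigma>0 u" if "u \<in> verts A" for u
      using that by (simp add: bests_def)
    then obtain \<sigma>1 where \<sigma>1: "\<sigma>1 \<in> strategies A P1"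
      and out: "\<And>u. u \<in> verts A \<Longrightarrow> Out A u \<sigma>0 \<sigma>1 = p u"
      using ex_strategy_following[OF \<sigma>0] by blast
    have "\<sigma>1 \<in> BR1 A d \<sigma>0"
      unfolding BR1_def
    proof (intro CollectI conjI ballI \<sigma>1)
      fix u \<sigma>1' assume "u \<in> verts A" "\<sigma>1' \<in> strategies A P1"
      then show "ds P1 (Out A u \<sigma>0 \<sigma>1') \<le> ds P1 (Out A u \<sigma>0 \<sigma>1)"
        using ds_le_best_value[OF Out_consistent[OF \<sigma>0]] p out by (simp add: bests_def)
    qed
    moreover have "\<pi> = Out A v \<sigma>0 \<sigma>1" using out[OF v] by (simp add: p_def)
    ultimately show "\<pi> \<in> (\<lambda>\<sigma>1. Out A v \<sigma>0 \<sigma>1) ` BR1 A d \<sigma>0" by blast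
  qed
qed

section \<open>Stackelberg values through thresholds\<close>

definition strat_value :: "bool \<Rightarrow> ('v list \<Rightarrow> 'v) \<Rightarrow> 'v \<Rightarrow> real" where
  "strat_value adv \<sigma> u = (if adv then ASV_strat A d \<sigma> u else CSV_strat A d \<sigma> u)"

definition stackelberg_value :: "bool \<Rightarrow> 'v \<Rightarrow> real" where
  "stackelberg_value adv u = (if adv then ASV A d u else CSV A d u)"

lemma stackelberg_value_eq:
  "stackelberg_value adv u = (SUP \<sigma>\<in>strategies A P0. strat_value adv \<sigma> u)"
  by (simp add: stackelberg_value_def strat_value_def ASV_def CSV_def)

lemma strat_value_bests:
  assumes "\<sigma> \<in> strategies A P0" "u \<in> verts A"
  shows "strat_value adv \<sigma> u = (if adv then INF \<pi>\<in>bests \<sigma> u. ds P0 \<pi> else SUP \<pi>\<in>bests \<sigma> u. ds P0 \<pi>)"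
  unfolding strat_value_def ASV_strat_def CSV_strat_def Out_BR1[OF assms, symmetric] image_image ..

text \<open>Bounded payoffs and the existence of a best play keep the conditional infimum and
  supremum meaningful. The second claim assumes a strict inequality so that a number below a
  supremum yields a witness.\<close>

lemma
  assumes \<sigma>: "\<sigma> \<in> strategies A P0" and u: "u \<in> verts A"
  shows good_le_strat_value: "good adv \<sigma> u t \<Longrightarrow> t \<le> strat_value adv \<sigma> u"
    and good_strat_value: "t < strat_value adv \<sigma> u \<Longrightarrow> good adv \<sigma> u t"
    and strat_value_le: "strat_value adv \<sigma> u \<le> K"
proof -
  obtain \<tau> where \<tau>: "\<tau> \<in> total_strategies" "\<And>u. consistent \<tau> u = consistent \<sigma> u"
    using ex_total_strategy[OF \<sigma>] by blast
  have ne: "bests \<sigma> u \<noteq> {}"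
    using bests_nonempty[OF \<tau>(1) u] bests_cong[OF \<tau>(2)] by simp
  have bound: "- K \<le> ds P0 \<pi> \<and> ds P0 \<pi> \<le> K" if "\<pi> \<in> bests \<sigma> u" for \<pi>
    using ds_bound[OF bests_play[OF that], of P0] by (simp add: abs_le_iff)
  have below: "bdd_below (ds P0 ` bests \<sigma> u)" and above: "bdd_above (ds P0 ` bests \<sigma> u)"
    using bound by (auto intro!: bdd_belowI2[where m = "- K"] bdd_aboveI2[where M = K])
  show "t \<le> strat_value adv \<sigma> u" if "good adv \<sigma> u t"
    using that ne above unfolding strat_value_bests[OF \<sigma> u] good_def
    by (auto intro: cINF_greatest cSUP_upper2 split: if_splits)
  show "good adv \<sigma> u t" if "t < strat_value adv \<sigma> u"
  proof (cases adv)
    case True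
    then have "t < (INF \<pi>\<in>bests \<sigma> u. ds P0 \<pi>)"
      using that by (simp add: strat_value_bests[OF \<sigma> u])
    then have "t \<le> ds P0 \<pi>" if "\<pi> \<in> bests \<sigma> u" for \<pi>
      using cINF_lower[OF below that] by linarith
    then show ?thesis using True by (simp add: good_def)
  next
    case False
    then have "t < (SUP \<pi>\<in>bests \<sigma> u. ds P0 \<pi>)"
      using that by (simp add: strat_value_bests[OF \<sigma> u])
    then show ?thesis
      using False less_cSUP_iff[OF ne above] by (auto simp: good_def intro: less_imp_le)
  qed
  obtain \<pi> where \<pi>: "\<pi> \<in> bests \<sigma> u" using ne by blast
  have "(INF \<pi>\<in>bests \<sigma> u. ds P0 \<pi>) \<le> K"
    using cINF_lower[OF below \<pi>] bound[OF \<pi>] by linarith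
  moreover have "(SUP \<pi>\<in>bests \<sigma> u. ds P0 \<pi>) \<le> K"
    using ne bound by (auto intro: cSUP_least)
  ultimately show "strat_value adv \<sigma> u \<le> K" by (simp add: strat_value_bests[OF \<sigma> u])
qed

lemma good_le_stackelberg_value:
  assumes "\<sigma> \<in> total_strategies" "u \<in> verts A" "good adv \<sigma> u t"
  shows "t \<le> stackelberg_value adv u"
proof -
  have \<sigma>: "\<sigma> \<in> strategies A P0" using assms(1) total_strategies_subset by blast
  have "bdd_above ((\<lambda>\<sigma>. strat_value adv \<sigma> u) ` strategies A P0)"
    using strat_value_le[OF _ assms(2)] by (intro bdd_aboveI2[where M = K])
  from cSUP_upper2[where f = "\<lambda>\<sigma>. strat_value adv \<sigma> u", OF this \<sigma> good_le_strat_value[OF \<sigma> assms(2,3)]] show ?thesis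
    unfolding stackelberg_value_eq .
qed

lemma ex_good_strategy:
  assumes "u \<in> verts A" "t < stackelberg_value adv u"
  obtains \<sigma> where "\<sigma> \<in> total_strategies" "good adv \<sigma> u t"
proof -
  obtain s where s: "\<And>u. u \<in> verts A \<Longrightarrow> (u, s u) \<in> edges A"
    using ex_edge by metis
  then have "(\<lambda>h. s (last h)) \<in> total_strategies" by (simp add: total_strategies_def)
  then have ne: "strategies A P0 \<noteq> {}" using total_strategies_subset by blast
  have "bdd_above ((\<lambda>\<sigma>. strat_value adv \<sigma> u) ` strategies A P0)"
    using strat_value_le[OF _ assms(1)] by (intro bdd_aboveI2[where M = K])
  then obtain \<sigma> where \<sigma>: "\<sigma> \<in> strategies A P0" "t < strat_value adv \<sigma> u"
    using assms(2) less_cSUP_iff[OF ne] by (auto simp: stackelberg_value_eq)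
  then have "good adv \<sigma> u t" using good_strat_value assms(1) by blast
  then show thesis using ex_total_strategy[OF \<sigma>(1)] good_cong that by metis
qed

end

section \<open>Depth-bounded strategies\<close>

context discounted_game
begin

text \<open>Vertices of \<open>Z\<close> minimise the payoff of Player 1 and all others maximise it:
  \<open>Z = {}\<close> describes the cooperative value, \<open>Z = owned A P0\<close> the zero-sum
  value under punishment. Attainment and bounds are separated so that a solution can be checked edge
  by edge.\<close>

definition bellman :: "'v set \<Rightarrow> ('v \<Rightarrow> real) \<Rightarrow> bool" where
  "bellman Z F \<longleftrightarrow> (\<forall>u\<in>verts A.
    (\<exists>j. (u, j) \<in> edges A \<and> F u = wt P1 u j + d * F j) \<and>
    (\<forall>j. (u, j) \<in> edges A \<longrightarrow>
      (if u \<in> Z then F u \<le> wt P1 u j + d * F j else wt P1 u j + d * F j \<le> F u)))"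

lemma bellman_succ:
  assumes "bellman Z F"
  obtains s where "\<And>u. u \<in> verts A \<Longrightarrow> (u, s u) \<in> edges A"
    "\<And>u. u \<in> verts A \<Longrightarrow> F u = wt P1 u (s u) + d * F (s u)"
  using assms unfolding bellman_def by metis

lemma bounded_on_play:
  fixes F :: "'v \<Rightarrow> real"
  shows "\<exists>C. \<forall>\<pi> k. is_play A \<pi> \<longrightarrow> \<bar>F (\<pi> k)\<bar> \<le> C"
proof (intro exI allI impI)
  fix \<pi> k assume "is_play A \<pi>"
  then show "\<bar>F (\<pi> k)\<bar> \<le> Max ((\<lambda>u. \<bar>F u\<bar>) ` verts A)"
    using finite_verts play_verts by (intro Max_ge) auto
qed

lemma ds_le_potential:
  assumes \<pi>: "is_play A \<pi>"
    and step: "\<And>k. wt P1 (\<pi> k) (\<pi> (Suc k)) + d * F (\<pi> (Suc k)) \<le> F (\<pi> k)"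
  shows "ds P1 \<pi> \<le> F (\<pi> 0)"
proof -
  obtain C where "\<And>k. \<bar>F (\<pi> k)\<bar> \<le> C" using bounded_on_play[of F] \<pi> by blast
  then show ?thesis
    unfolding ds_def
    by (intro suminf_le_discounted[OF d_pos d_less_1 _ _ summable_play[OF \<pi>], where F = "\<lambda>k. F (\<pi> k)"] step \<pi>)
qed

lemma potential_le_ds:
  assumes \<pi>: "is_play A \<pi>"
    and step: "\<And>k. F (\<pi> k) \<le> wt P1 (\<pi> k) (\<pi> (Suc k)) + d * F (\<pi> (Suc k))"
  shows "F (\<pi> 0) \<le> ds P1 \<pi>"
proof -
  obtain C where "\<And>k. \<bar>F (\<pi> k)\<bar> \<le> C" using bounded_on_play[of F] \<pi> by blast
  then show ?thesis
    unfolding ds_def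
    by (intro discounted_le_suminf[OF d_pos d_less_1 _ _ summable_play[OF \<pi>], where F = "\<lambda>k. F (\<pi> k)"] step \<pi>)
qed

lemma play_edge: "is_play A \<pi> \<Longrightarrow> (\<pi> k, \<pi> (Suc k)) \<in> edges A"
  by (simp add: is_play_def)

lemma best_value_le_cooperative:
  assumes F: "bellman {} F" and \<sigma>: "\<sigma> \<in> total_strategies" and u: "u \<in> verts A"
  shows "best_value \<sigma> u \<le> F u"
proof (rule best_value_le[OF \<sigma> u])
  fix \<pi> assume \<pi>: "\<pi> \<in> consistent \<sigma> u"
  note play = consistent_play[OF \<pi>]
  have "wt P1 (\<pi> k) (\<pi> (Suc k)) + d * F (\<pi> (Suc k)) \<le> F (\<pi> k)" for k
    using F play_verts[OF play] play_edge[OF play] by (simp add: bellman_def)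
  from ds_le_potential[OF play this] consistent_0[OF \<pi>] show "ds P1 \<pi> \<le> F u" by simp
qed

text \<open>Player 1 moves along successors that attain the equation. At vertices of Player 0 the
  inequality holds for every edge, so no strategy of Player 0 pushes the payoff below
  \<open>F\<close>.\<close>

lemma zero_sum_le_best_value:
  assumes F: "bellman (owned A P0) F" and \<sigma>: "\<sigma> \<in> total_strategies" and u: "u \<in> verts A"
  shows "F u \<le> best_value \<sigma> u"
proof -
  obtain s where s: "\<And>u. u \<in> verts A \<Longrightarrow> (u, s u) \<in> edges A"
    "\<And>u. u \<in> verts A \<Longrightarrow> F u = wt P1 u (s u) + d * F (s u)"
    using bellman_succ[OF F] by blast
  obtain \<pi> where \<pi>: "\<pi> \<in> consistent \<sigma> u" "\<And>k. \<pi> k \<notin> owned A P0 \<Longrightarrow> \<pi> (Suc k) = s (\<pi> k)"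
    using ex_consistent_against[OF \<sigma> u s(1)] by blast
  note play = consistent_play[OF \<pi>(1)]
  have "F (\<pi> k) \<le> wt P1 (\<pi> k) (\<pi> (Suc k)) + d * F (\<pi> (Suc k))" for k
  proof (cases "\<pi> k \<in> owned A P0")
    case True
    then show ?thesis
      using F play_verts[OF play, of k] play_edge[OF play, of k] by (simp add: bellman_def)
  next
    case False
    then show ?thesis using \<pi>(2) s(2)[OF play_verts[OF play, of k]] by simp
  qed
  from potential_le_ds[OF play this] ds_le_best_value[OF \<pi>(1)] consistent_0[OF \<pi>(1)]
  show ?thesis by simp
qed

text \<open>Covers both kinds of tails. Player 0 moves along successors that attain the equation. It
  follows that any solution of the equations, however found, is the value of a tail.\<close>

lemma ex_positional_strategy:
  assumes F: "bellman Z F" and sub: "Z \<subseteq> owned A P0"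
  obtains \<sigma> where "\<sigma> \<in> total_strategies" "\<And>u. u \<in> verts A \<Longrightarrow> best_value \<sigma> u = F u"
proof -
  obtain s where s: "\<And>u. u \<in> verts A \<Longrightarrow> (u, s u) \<in> edges A"
    "\<And>u. u \<in> verts A \<Longrightarrow> F u = wt P1 u (s u) + d * F (s u)"
    using bellman_succ[OF F] by blast
  define \<sigma> where "\<sigma> h = s (last h)" for h
  have \<sigma>: "\<sigma> \<in> total_strategies" using s(1) by (simp add: total_strategies_def \<sigma>_def)
  show thesis
  proof (rule that[OF \<sigma>])
    fix u assume u: "u \<in> verts A"
    have follow: "\<pi> (Suc k) = s (\<pi> k)" if "\<pi> \<in> consistent \<sigma> u" "\<pi> k \<in> owned A P0" for \<pi> k
      using that by (simp add: consistent_def follows_def \<sigma>_def last_map)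
    have "best_value \<sigma> u \<le> F u"
    proof (rule best_value_le[OF \<sigma> u])
      fix \<pi> assume \<pi>: "\<pi> \<in> consistent \<sigma> u"
      note play = consistent_play[OF \<pi>]
      have "wt P1 (\<pi> k) (\<pi> (Suc k)) + d * F (\<pi> (Suc k)) \<le> F (\<pi> k)" for k
      proof (cases "\<pi> k \<in> Z")
        case True
        then have "\<pi> (Suc k) = s (\<pi> k)" using sub follow[OF \<pi>] by blast
        then show ?thesis using s(2)[OF play_verts[OF play, of k]] by simp
      next
        case False
        then show ?thesis
          using F play_verts[OF play, of k] play_edge[OF play, of k] by (simp add: bellman_def)
      qed
      from ds_le_potential[OF play this] consistent_0[OF \<pi>] show "ds P1 \<pi> \<le> F u" by simp
    qed
    moreover obtain \<pi> where \<pi>: "\<pi> \<in> consistent \<sigma> u"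
      "\<And>k. \<pi> k \<notin> owned A P0 \<Longrightarrow> \<pi> (Suc k) = s (\<pi> k)"
      using ex_consistent_against[OF \<sigma> u s(1)] by blast
    note play = consistent_play[OF \<pi>(1)]
    \<comment> \<open>Player 1 uses the same successors as Player 0, so each step of this play is an
      equality.\<close>
    have "\<pi> (Suc k) = s (\<pi> k)" for k using \<pi>(2) follow[OF \<pi>(1)] by blast
    then have "F (\<pi> k) \<le> wt P1 (\<pi> k) (\<pi> (Suc k)) + d * F (\<pi> (Suc k))" for k
      using s(2)[OF play_verts[OF play, of k]] by simp
    from potential_le_ds[OF play this] ds_le_best_value[OF \<pi>(1)] consistent_0[OF \<pi>(1)]
    have "F u \<le> best_value \<sigma> u" by simp
    ultimately show "best_value \<sigma> u = F u" by simp
  qed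
qed

text \<open>Glues a first move and one strategy per successor. Agreement on the consistent plays is
  enough, because \<open>best_value\<close>, \<open>bests\<close> and \<open>good\<close> depend on
  nothing else.\<close>

lemma ex_composed_strategy:
  assumes ui: "(u, i) \<in> edges A" and \<tau>: "\<And>j. (u, j) \<in> edges A \<Longrightarrow> \<tau> j \<in> total_strategies"
  obtains \<sigma> where "\<sigma> \<in> total_strategies"
    "allowed \<sigma> u = (if u \<in> owned A P0 then {i} else {j. (u, j) \<in> edges A})"
    "\<And>j. (u, j) \<in> edges A \<Longrightarrow> consistent (shift \<sigma> u) j = consistent (\<tau> j) j"
proof -
  obtain s where s: "\<And>u. u \<in> verts A \<Longrightarrow> (u, s u) \<in> edges A"
    using ex_edge by metis
  \<comment> \<open>The fallback \<open>s\<close> is for lists that are neither \<open>[u]\<close>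
    nor continue along an edge from \<open>u\<close>; \<open>total_strategies\<close> constrains
    these as well.\<close>
  define \<sigma> where "\<sigma> h = (if h = [u] then i
    else if hd h = u \<and> tl h \<noteq> [] \<and> (u, hd (tl h)) \<in> edges A then \<tau> (hd (tl h)) (tl h) else s (last h))" for h
  show thesis
  proof
    show "\<sigma> \<in> total_strategies"
      unfolding total_strategies_def
    proof (intro CollectI allI impI)
      fix h assume h: "h \<noteq> []" "last h \<in> verts A"
      show "(last h, \<sigma> h) \<in> edges A"
      proof (cases "h \<noteq> [u] \<and> hd h = u \<and> tl h \<noteq> [] \<and> (u, hd (tl h)) \<in> edges A")
        case True
        then have "\<sigma> h = \<tau> (hd (tl h)) (tl h)" by (simp add: \<sigma>_def)
        moreover have "last (tl h) = last h" using True by (simp add: last_tl)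
        ultimately show ?thesis using total_strategiesD[OF \<tau>, of "hd (tl h)" "tl h"] True h by simp
      next
        case False
        then show ?thesis using ui s[OF h(2)] by (auto simp: \<sigma>_def)
      qed
    qed
    show "allowed \<sigma> u = (if u \<in> owned A P0 then {i} else {j. (u, j) \<in> edges A})"
      using ui by (auto simp: allowed_def \<sigma>_def)
    fix j assume j: "(u, j) \<in> edges A"
    show "consistent (shift \<sigma> u) j = consistent (\<tau> j) j"
    proof (rule consistent_cong)
      fix h assume "is_history A h" "hd h = j"
      then show "shift \<sigma> u h = \<tau> j h" using is_history_not_Nil j by (auto simp: shift_def \<sigma>_def)
    qed
  qed
qed

end

text \<open>
  Throughout, \<open>adv\<close> selects the adversarial value. A pair holds the payoff of Player 1 under best
  response and that of Player 0. If \<open>q\<close> is dominated by \<open>p\<close>, then adding a branch with payoffs \<open>q\<close> to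
  the choices of Player 1 does not spoil the guarantee \<open>p\<close>: in the cooperative case ties are broken
  in favour of Player 0, so the second component of \<open>q\<close> is irrelevant.
\<close>

definition dominated :: "bool \<Rightarrow> 'a::linorder \<times> 'b::linorder \<Rightarrow> 'a \<times> 'b \<Rightarrow> bool" where
  "dominated adv q p \<longleftrightarrow> (if adv then fst q < fst p \<or> fst q = fst p \<and> snd p \<le> snd q else fst q \<le> fst p)"

lemma dominated_fst: "dominated adv q p \<Longrightarrow> fst q \<le> fst p"
  by (auto simp: dominated_def split: if_splits)

lemma dominated_trans: "dominated adv p q \<Longrightarrow> dominated adv q r \<Longrightarrow> dominated adv p r"
  by (auto simp: dominated_def split: if_splits)

lemma dominated_linear: "dominated adv p q \<or> dominated adv q p"
  by (auto simp: dominated_def)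

text \<open>\<open>dominated adv\<close> is a total preorder. A greatest element among the branches
  decides the payoffs at a vertex of Player 1.\<close>

lemma ex_dominating:
  assumes "finite I" "I \<noteq> {}"
  shows "\<exists>i\<in>I. \<forall>j\<in>I. dominated adv (f j) (f i)"
  using assms
proof (induction rule: finite_ne_induct)
  case (singleton x)
  then show ?case using dominated_linear by blast
next
  case (insert x I)
  then obtain i where i: "i \<in> I" "\<forall>j\<in>I. dominated adv (f j) (f i)" by blast
  show ?case
  proof (cases "dominated adv (f x) (f i)")
    case True
    then show ?thesis using i by blast
  next
    case False
    then have "dominated adv (f i) (f x)" using dominated_linear by blast
    then have "\<forall>j\<in>insert x I. dominated adv (f j) (f x)"
      using i(2) dominated_trans dominated_linear by blast
    then show ?thesis by blast
  qed
qed

section \<open>Achievable payoff pairs\<close>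

locale solved_game = discounted_game +
  fixes M V :: "'a \<Rightarrow> real"
  assumes M: "bellman {} M" and V: "bellman (owned A P0) V"
begin

definition extend :: "'a \<Rightarrow> 'a \<Rightarrow> real \<times> real \<Rightarrow> real \<times> real" where
  "extend u j q = (wt P1 u j + d * fst q, wt P0 u j + d * snd q)"

text \<open>The 0 stands for the unknown payoff of Player 0 on a tail. At a vertex of Player 1,
  \<open>p\<close> belongs to the branch that is taken, so every branch must offer some pair that
  \<open>p\<close> dominates.\<close>

primrec pairs :: "bool \<Rightarrow> nat \<Rightarrow> 'a \<Rightarrow> (real \<times> real) set" where
  "pairs adv 0 u = {(M u, 0), (V u, 0)}"
| "pairs adv (Suc n) u = {p. \<exists>j q. (u, j) \<in> edges A \<and> q \<in> pairs adv n j \<and> p = extend u j q \<and>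
    (u \<in> owned A P1 \<longrightarrow>
      (\<forall>j'. (u, j') \<in> edges A \<longrightarrow> (\<exists>q'\<in>pairs adv n j'. dominated adv (extend u j' q') p)))}"

text \<open>The first component is realised exactly, since ties depend on it; only the second
  carries the error of the tails, discounted once per round. The strategy is glued from those that
  the induction hypothesis gives for the successors.\<close>

lemma pairs_sound:
  assumes "u \<in> verts A" "p \<in> pairs adv n u"
  shows "\<exists>\<sigma>\<in>total_strategies. best_value \<sigma> u = fst p \<and> good adv \<sigma> u (snd p - K * d ^ n)"
  using assms
proof (induction n arbitrary: u p)
  case 0
  obtain F Z where F: "bellman Z F" "Z \<subseteq> owned A P0" "fst p = F u"
    using 0(2) M V by auto
  obtain \<sigma> where "\<sigma> \<in> total_strategies" "best_value \<sigma> u = fst p"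
    using ex_positional_strategy[OF F(1,2)] F(3) 0(1) by metis
  moreover have "snd p = 0" using 0 by auto
  ultimately show ?case using good_minus_K[OF _ 0(1)] by auto
next
  case (Suc n)
  then obtain i q where ui: "(u, i) \<in> edges A" and q: "q \<in> pairs adv n i" and p: "p = extend u i q"
    and dom: "u \<in> owned A P1 \<Longrightarrow> (u, j') \<in> edges A \<Longrightarrow>
      \<exists>q'\<in>pairs adv n j'. dominated adv (extend u j' q') p" for j'
    by auto
  \<comment> \<open>One pair is fixed per successor. The branch \<open>i\<close> must keep the pair
    \<open>q\<close> from which \<open>p\<close> arises; at a vertex of Player 1 the remaining
    branches receive a pair dominated by \<open>p\<close>.\<close>
  define Q where "Q j q' \<longleftrightarrow> q' \<in> pairs adv n j \<and> (j = i \<longrightarrow> q' = q) \<and>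
    (j \<noteq> i \<longrightarrow> u \<in> owned A P1 \<longrightarrow> dominated adv (extend u j q') p)" for j q'
  have "\<exists>q'. Q j q'" if "(u, j) \<in> edges A" "u \<in> owned A P1 \<or> j = i" for j
    using that q dom unfolding Q_def by blast
  then obtain r where r: "\<And>j. (u, j) \<in> edges A \<Longrightarrow> u \<in> owned A P1 \<or> j = i \<Longrightarrow> Q j (r j)"
    by metis
  have "\<exists>\<sigma>\<in>total_strategies. (u \<in> owned A P1 \<or> j = i \<longrightarrow>
      best_value \<sigma> j = fst (r j) \<and> good adv \<sigma> j (snd (r j) - K * d ^ n))" if "(u, j) \<in> edges A" for j
  proof (cases "u \<in> owned A P1 \<or> j = i")
    case True
    then have "r j \<in> pairs adv n j" using r[OF that] by (simp add: Q_def)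
    then show ?thesis using Suc.IH[of j "r j"] edge_verts[OF that] by auto
  next
    case False
    \<comment> \<open>At a vertex of Player 0 the play never enters these successors, so any
      strategy serves there.\<close>
    obtain \<sigma> where "\<sigma> \<in> total_strategies" by (rule ex_positional_strategy[OF M]) auto
    then show ?thesis using False by blast
  qed
  then obtain \<tau> where \<tau>: "\<And>j. (u, j) \<in> edges A \<Longrightarrow> \<tau> j \<in> total_strategies"
    and \<tau>_val: "\<And>j. (u, j) \<in> edges A \<Longrightarrow> u \<in> owned A P1 \<or> j = i \<Longrightarrow>
      best_value (\<tau> j) j = fst (r j) \<and> good adv (\<tau> j) j (snd (r j) - K * d ^ n)"
    by metis
  obtain \<sigma> where \<sigma>: "\<sigma> \<in> total_strategies"
    "allowed \<sigma> u = (if u \<in> owned A P0 then {i} else {j. (u, j) \<in> edges A})"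
    "\<And>j. (u, j) \<in> edges A \<Longrightarrow> consistent (shift \<sigma> u) j = consistent (\<tau> j) j"
    using ex_composed_strategy[where \<tau> = \<tau>, OF ui \<tau>] by blast
  have al: "(u, j) \<in> edges A \<and> (u \<in> owned A P1 \<or> j = i)" if "j \<in> allowed \<sigma> u" for j
    using that \<sigma>(2) ui owned_P1_iff[OF Suc.prems(1)] by (auto split: if_splits)
  have i: "i \<in> allowed \<sigma> u" using \<sigma>(2) ui by auto
  have ri: "r i = q" using r[OF ui] by (simp add: Q_def)
  have val: "best_value (shift \<sigma> u) j = fst (r j)" "good adv (shift \<sigma> u) j (snd (r j) - K * d ^ n)"
    if "j \<in> allowed \<sigma> u" for j
    using al[OF that] \<tau>_val[of j] best_value_cong[OF \<sigma>(3)] good_cong[OF \<sigma>(3)] by auto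
  have rdom: "extend u j (r j) = p \<or> dominated adv (extend u j (r j)) p" if "j \<in> allowed \<sigma> u" for j
    using al[OF that] r[of j] ri p dom unfolding Q_def by blast
  have up: "wt P1 u j + d * best_value (shift \<sigma> u) j \<le> fst p" if "j \<in> allowed \<sigma> u" for j
    using rdom[OF that] dominated_fst val(1)[OF that] by (fastforce simp: extend_def)
  have iv: "wt P1 u i + d * best_value (shift \<sigma> u) i = fst p"
    using val(1)[OF i] ri p by (simp add: extend_def)
  have bv: "best_value \<sigma> u = fst p"
  proof (rule antisym)
    obtain j where "j \<in> allowed \<sigma> u" "best_value \<sigma> u = wt P1 u j + d * best_value (shift \<sigma> u) j"
      using best_value_attained[OF \<sigma>(1) Suc.prems(1)] by blast
    then show "best_value \<sigma> u \<le> fst p" using up by simp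
    show "fst p \<le> best_value \<sigma> u" using best_value_ge_succ[OF \<sigma>(1) i] iv by simp
  qed
  have scale: "snd (extend u j (r j)) - K * d ^ Suc n \<le> wt P0 u j + d * ds P0 \<rho>"
    if "snd (r j) - K * d ^ n \<le> ds P0 \<rho>" for j \<rho>
    using mult_left_mono[OF that, of d] d_pos by (simp add: extend_def algebra_simps)
  have "good adv \<sigma> u (snd p - K * d ^ Suc n)"
  proof (cases adv)
    case True
    \<comment> \<open>A best play can enter a branch other than \<open>i\<close> only on a tie in
      the first component, and then domination bounds its second component from below.\<close>
    have "snd p - K * d ^ Suc n \<le> ds P0 \<pi>" if \<pi>: "\<pi> \<in> bests \<sigma> u" for \<pi>
    proof -
      obtain \<rho> where \<rho>: "\<rho> 0 \<in> allowed \<sigma> u" "\<rho> \<in> bests (shift \<sigma> u) (\<rho> 0)"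
        "wt P1 u (\<rho> 0) + d * best_value (shift \<sigma> u) (\<rho> 0) = best_value \<sigma> u"
        "ds P0 \<pi> = wt P0 u (\<rho> 0) + d * ds P0 \<rho>"
        using bests_cases[OF \<sigma>(1) \<pi>] by blast
      have "fst (extend u (\<rho> 0) (r (\<rho> 0))) = fst p"
        using \<rho>(3) bv val(1)[OF \<rho>(1)] by (simp add: extend_def)
      then have "snd p \<le> snd (extend u (\<rho> 0) (r (\<rho> 0)))"
        using rdom[OF \<rho>(1)] True by (auto simp: dominated_def)
      moreover have "snd (r (\<rho> 0)) - K * d ^ n \<le> ds P0 \<rho>"
        using val(2)[OF \<rho>(1)] \<rho>(2) True by (simp add: good_def)
      ultimately show ?thesis using scale \<rho>(4) by fastforce
    qed
    then show ?thesis using True by (simp add: good_def)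
  next
    case False
    then obtain \<rho> where \<rho>: "\<rho> \<in> bests (shift \<sigma> u) i" "snd q - K * d ^ n \<le> ds P0 \<rho>"
      using val(2)[OF i] ri by (auto simp: good_def)
    then have \<rho>0: "\<rho> 0 = i" by (simp add: bests_def consistent_def)
    then have b: "case_nat u \<rho> \<in> bests \<sigma> u"
      using \<rho> i iv bv by (simp add: bests_Cons[OF \<sigma>(1)])
    have "ds P0 (case_nat u \<rho>) = wt P0 u i + d * ds P0 \<rho>"
      using ds_Cons[OF bests_play[OF b]] \<rho>0 by simp
    then have "snd p - K * d ^ Suc n \<le> ds P0 (case_nat u \<rho>)"
      using scale[of i \<rho>] \<rho>(2) ri p by simp
    then have "\<exists>\<pi>\<in>bests \<sigma> u. snd p - K * d ^ Suc n \<le> ds P0 \<pi>" using b by blast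
    then show ?thesis using False by (simp add: good_def)
  qed
  with \<sigma>(1) bv show ?case by blast
qed

lemma pairs_SucI:
  assumes u: "u \<in> verts A" and q: "\<And>j. (u, j) \<in> edges A \<Longrightarrow> q j \<in> pairs adv n j"
    and i: "(u, i) \<in> edges A"
    and dom: "\<And>j. (u, j) \<in> edges A \<Longrightarrow> u \<in> owned A P1 \<Longrightarrow> dominated adv (extend u j (q j)) (extend u i (q i))"
  shows "extend u i (q i) \<in> pairs adv (Suc n) u"
proof -
  have "\<forall>j. (u, j) \<in> edges A \<longrightarrow> (\<exists>q'\<in>pairs adv n j. dominated adv (extend u j q') (extend u i (q i)))"
    if "u \<in> owned A P1"
    using q dom that by blast
  then show ?thesis unfolding pairs.simps using i q[OF i] by blast
qed

text \<open>Punishing after every history lowers the payoff of Player 1 throughout. These pairs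
  serve for the branches that must stay unattractive.\<close>

lemma pairs_below:
  assumes "\<sigma> \<in> total_strategies" "u \<in> verts A"
  shows "\<exists>p\<in>pairs adv n u. fst p \<le> best_value \<sigma> u"
  using assms
proof (induction n arbitrary: \<sigma> u)
  case 0
  then show ?case using zero_sum_le_best_value[OF V] by auto
next
  case (Suc n)
  have "\<exists>q\<in>pairs adv n j. fst q \<le> best_value (shift \<sigma> u) j" if "(u, j) \<in> edges A" for j
    using Suc.IH[OF shift_total[OF Suc.prems(1)], of j] edge_verts[OF that] by blast
  then obtain q where q: "\<And>j. (u, j) \<in> edges A \<Longrightarrow> q j \<in> pairs adv n j"
    "\<And>j. (u, j) \<in> edges A \<Longrightarrow> fst (q j) \<le> best_value (shift \<sigma> u) j"
    by metis
  \<comment> \<open>The dominating branch need not be optimal against \<open>\<sigma>\<close>, but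
    its lowered payoff is still at most the best value of \<open>u\<close>.\<close>
  obtain i where i: "i \<in> allowed \<sigma> u"
    "\<forall>j\<in>allowed \<sigma> u. dominated adv (extend u j (q j)) (extend u i (q i))"
    using ex_dominating[OF finite_allowed allowed_nonempty[OF Suc.prems], of adv "\<lambda>j. extend u j (q j)"]
    by blast
  have ui: "(u, i) \<in> edges A" by (rule allowed_edge[OF i(1)])
  have "extend u i (q i) \<in> pairs adv (Suc n) u"
    using i(2) owned_P1_iff[OF Suc.prems(2)] by (intro pairs_SucI Suc.prems q ui) (auto simp: allowed_def)
  moreover have "fst (extend u i (q i)) \<le> wt P1 u i + d * best_value (shift \<sigma> u) i"
    using q(2)[OF ui] d_pos by (simp add: extend_def)
  then have "fst (extend u i (q i)) \<le> best_value \<sigma> u"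
    using best_value_ge_succ[OF Suc.prems(1) i(1)] by linarith
  ultimately show ?case by blast
qed

text \<open>Equality in the first component would be too much to ask. The inequality points upwards
  so that the kept branches still win against the others, which \<open>pairs_below\<close> moves
  downwards.\<close>

lemma pairs_complete:
  assumes "\<sigma> \<in> total_strategies" "u \<in> verts A" "good adv \<sigma> u t"
  shows "\<exists>p\<in>pairs adv n u. best_value \<sigma> u \<le> fst p \<and> t - K * d ^ n \<le> snd p"
  using assms
proof (induction n arbitrary: \<sigma> u t)
  case 0
  have "t \<le> K"
  proof -
    obtain \<pi> where \<pi>: "\<pi> \<in> bests \<sigma> u" "t \<le> ds P0 \<pi>"
      using 0(3) bests_nonempty[OF 0(1,2)] by (auto simp: good_def split: if_splits)
    then show ?thesis using ds_bound[OF bests_play[OF \<pi>(1)], of P0] by (simp add: abs_le_iff)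
  qed
  then show ?case using best_value_le_cooperative[OF M 0(1,2)] by auto
next
  case (Suc n)
  note \<sigma> = Suc.prems(1) and u = Suc.prems(2)
  define f where "f j = wt P1 u j + d * best_value (shift \<sigma> u) j" for j
  \<comment> \<open>The payoff of Player 0 needed from \<open>j\<close> onwards for the total to
    reach \<open>t\<close>.\<close>
  define t' where "t' j = (t - wt P0 u j) / d" for j
  have play: "case_nat u \<rho> \<in> bests \<sigma> u" "ds P0 (case_nat u \<rho>) = wt P0 u j + d * ds P0 \<rho>"
    if j: "j \<in> allowed \<sigma> u" "f j = best_value \<sigma> u" "\<rho> \<in> bests (shift \<sigma> u) j" for j \<rho>
  proof -
    have \<rho>0: "\<rho> 0 = j" using j(3) by (simp add: bests_def consistent_def)
    then show b: "case_nat u \<rho> \<in> bests \<sigma> u" using j by (simp add: bests_Cons[OF \<sigma>] f_def)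
    show "ds P0 (case_nat u \<rho>) = wt P0 u j + d * ds P0 \<rho>"
      using ds_Cons[OF bests_play[OF b]] \<rho>0 by simp
  qed
  have le_t': "t' j \<le> x \<longleftrightarrow> t \<le> wt P0 u j + d * x" for j x
    using d_pos by (auto simp: t'_def field_simps)
  have f_le: "f j \<le> best_value \<sigma> u" if "j \<in> allowed \<sigma> u" for j
    using best_value_ge_succ[OF \<sigma> that] by (simp add: f_def)
  have below: "\<exists>q\<in>pairs adv n j. fst (extend u j q) \<le> f j" if "(u, j) \<in> edges A" for j
    using pairs_below[OF shift_total[OF \<sigma>], of j adv n u] edge_verts[OF that] d_pos
    by (auto simp: extend_def f_def)
  have above: "\<exists>q\<in>pairs adv n j. f j \<le> fst (extend u j q) \<and> t - K * d ^ Suc n \<le> snd (extend u j q)"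
    if uj: "(u, j) \<in> edges A" and gj: "good adv (shift \<sigma> u) j (t' j)" for j
  proof -
    obtain q where q: "q \<in> pairs adv n j" "best_value (shift \<sigma> u) j \<le> fst q" "t' j \<le> snd q + K * d ^ n"
      using Suc.IH[OF shift_total[OF \<sigma>] _ gj] edge_verts[OF uj] by (auto simp: algebra_simps)
    have "f j \<le> fst (extend u j q)" using q(2) d_pos by (simp add: f_def extend_def)
    moreover have "t - K * d ^ Suc n \<le> snd (extend u j q)"
      using q(3) unfolding le_t' by (simp add: extend_def algebra_simps)
    ultimately show ?thesis using q(1) by blast
  qed
  \<comment> \<open>Tails are made cooperative on \<open>J\<close> and punishing elsewhere.\<close>
  have main: ?case
    if J: "J \<subseteq> {j \<in> allowed \<sigma> u. f j = best_value \<sigma> u \<and> good adv (shift \<sigma> u) j (t' j)}"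
      and dom: "\<And>q. (\<And>j. j \<in> J \<Longrightarrow> best_value \<sigma> u \<le> fst (extend u j (q j))) \<Longrightarrow>
        (\<And>j. j \<in> allowed \<sigma> u \<Longrightarrow> j \<notin> J \<Longrightarrow> fst (extend u j (q j)) \<le> f j) \<Longrightarrow>
        \<exists>i\<in>J. \<forall>j\<in>allowed \<sigma> u. dominated adv (extend u j (q j)) (extend u i (q i))" for J
  proof -
    have "\<exists>q\<in>pairs adv n j. if j \<in> J then f j \<le> fst (extend u j q) \<and> t - K * d ^ Suc n \<le> snd (extend u j q)
        else fst (extend u j q) \<le> f j" if "(u, j) \<in> edges A" for j
      using above[OF that] below[OF that] J by (cases "j \<in> J") auto
    then obtain q where q: "\<And>j. (u, j) \<in> edges A \<Longrightarrow> q j \<in> pairs adv n j"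
      "\<And>j. (u, j) \<in> edges A \<Longrightarrow>
        (if j \<in> J then f j \<le> fst (extend u j (q j)) \<and> t - K * d ^ Suc n \<le> snd (extend u j (q j))
          else fst (extend u j (q j)) \<le> f j)"
      by metis
    have J_edge: "(u, j) \<in> edges A" if "j \<in> J" for j using that J allowed_edge by blast
    have qJ: "best_value \<sigma> u \<le> fst (extend u j (q j))" "t - K * d ^ Suc n \<le> snd (extend u j (q j))"
      if "j \<in> J" for j
      using q(2)[OF J_edge[OF that]] that J by auto
    have "fst (extend u j (q j)) \<le> f j" if "j \<in> allowed \<sigma> u" "j \<notin> J" for j
      using q(2)[OF allowed_edge[OF that(1)]] that(2) by simp
    then obtain i where i: "i \<in> J"
      "\<forall>j\<in>allowed \<sigma> u. dominated adv (extend u j (q j)) (extend u i (q i))"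
      using dom[of q] qJ by blast
    have "extend u i (q i) \<in> pairs adv (Suc n) u"
      using i(2) owned_P1_iff[OF u]
      by (intro pairs_SucI[where q = q, OF u q(1) J_edge[OF i(1)]]) (auto simp: allowed_def)
    then show ?thesis using qJ[OF i(1)] by blast
  qed
  show ?case
  proof (cases adv)
    case True
    \<comment> \<open>Player 1 may pick any optimal successor, so all of them are kept. Each is good
      because its best plays extend to best plays from \<open>u\<close>.\<close>
    define J where "J = {j \<in> allowed \<sigma> u. f j = best_value \<sigma> u}"
    show ?thesis
    proof (rule main)
      have "t' j \<le> ds P0 \<rho>" if "j \<in> J" "\<rho> \<in> bests (shift \<sigma> u) j" for j \<rho>
        using play[of j \<rho>] that Suc.prems(3) True by (auto simp: J_def good_def le_t')
      then show "J \<subseteq> {j \<in> allowed \<sigma> u. f j = best_value \<sigma> u \<and> good adv (shift \<sigma> u) j (t' j)}"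
        using True by (auto simp: J_def good_def)
      fix q assume J: "\<And>j. j \<in> J \<Longrightarrow> best_value \<sigma> u \<le> fst (extend u j (q j))"
        and nJ: "\<And>j. j \<in> allowed \<sigma> u \<Longrightarrow> j \<notin> J \<Longrightarrow> fst (extend u j (q j)) \<le> f j"
      obtain i where i: "i \<in> allowed \<sigma> u"
        "\<forall>j\<in>allowed \<sigma> u. dominated adv (extend u j (q j)) (extend u i (q i))"
        using ex_dominating[OF finite_allowed allowed_nonempty[OF \<sigma> u], of adv "\<lambda>j. extend u j (q j)"]
        by blast
      obtain j where j: "j \<in> allowed \<sigma> u" "f j = best_value \<sigma> u"
        using best_value_attained[OF \<sigma> u] unfolding f_def by metis
      then have "best_value \<sigma> u \<le> fst (extend u j (q j))" using J by (simp add: J_def)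
      also have "\<dots> \<le> fst (extend u i (q i))" using i(2) j(1) dominated_fst by blast
      \<comment> \<open>Outside \<open>J\<close> the lowered payoff stays strictly below the best
        value of \<open>u\<close>, which the dominating branch reaches.\<close>
      finally have "i \<in> J"
        using nJ[OF i(1)] f_le[OF i(1)] i(1) unfolding J_def by force
      with i(2) show "\<exists>i\<in>J. \<forall>j\<in>allowed \<sigma> u. dominated adv (extend u j (q j)) (extend u i (q i))"
        by blast
    qed
  next
    case False
    then obtain \<pi> where \<pi>: "\<pi> \<in> bests \<sigma> u" "t \<le> ds P0 \<pi>"
      using Suc.prems(3) by (auto simp: good_def)
    obtain \<rho> where \<rho>: "\<rho> 0 \<in> allowed \<sigma> u" "\<rho> \<in> bests (shift \<sigma> u) (\<rho> 0)"
      "f (\<rho> 0) = best_value \<sigma> u" "ds P0 \<pi> = wt P0 u (\<rho> 0) + d * ds P0 \<rho>"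
      using bests_cases[OF \<sigma> \<pi>(1)] unfolding f_def by blast
    \<comment> \<open>Only the branch of \<open>\<pi>\<close> is known to be good, so it alone is
      kept. Other optimal branches may remain tied with it, as ties are broken in favour of Player
      0.\<close>
    show ?thesis
    proof (rule main)
      have "t' (\<rho> 0) \<le> ds P0 \<rho>" using \<pi>(2) \<rho>(4) by (simp add: le_t')
      then show "{\<rho> 0} \<subseteq> {j \<in> allowed \<sigma> u. f j = best_value \<sigma> u \<and> good adv (shift \<sigma> u) j (t' j)}"
        using \<rho> False by (auto simp: good_def)
      fix q assume "\<And>j. j \<in> {\<rho> 0} \<Longrightarrow> best_value \<sigma> u \<le> fst (extend u j (q j))"
        and nJ: "\<And>j. j \<in> allowed \<sigma> u \<Longrightarrow> j \<notin> {\<rho> 0} \<Longrightarrow> fst (extend u j (q j)) \<le> f j"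
      then have "best_value \<sigma> u \<le> fst (extend u (\<rho> 0) (q (\<rho> 0)))" by simp
      then have "fst (extend u j (q j)) \<le> fst (extend u (\<rho> 0) (q (\<rho> 0)))" if "j \<in> allowed \<sigma> u" for j
        using nJ[OF that] f_le[OF that] by (cases "j = \<rho> 0") auto
      then show "\<exists>i\<in>{\<rho> 0}. \<forall>j\<in>allowed \<sigma> u. dominated adv (extend u j (q j)) (extend u i (q i))"
        using False by (simp add: dominated_def)
    qed
  qed
qed

lemma le_stackelberg_value:
  assumes "u \<in> verts A" "p \<in> pairs adv n u"
  shows "snd p - K * d ^ n \<le> stackelberg_value adv u"
  using pairs_sound[OF assms] good_le_stackelberg_value[OF _ assms(1)] by blast

lemma less_stackelberg_value:
  assumes "u \<in> verts A" "t < stackelberg_value adv u"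
  shows "\<exists>p\<in>pairs adv n u. t - K * d ^ n \<le> snd p"
proof -
  obtain \<sigma> where "\<sigma> \<in> total_strategies" "good adv \<sigma> u t"
    using ex_good_strategy[OF assms] by blast
  then show ?thesis using pairs_complete[OF _ assms(1)] by blast
qed

end

section \<open>Rational solutions of the Bellman equations\<close>

lemma common_denominator:
  assumes "finite S" "S \<subseteq> (\<rat> :: real set)"
  shows "\<exists>D::int. 0 < D \<and> (\<forall>x\<in>S. \<exists>p::int. x = of_int p / of_int D)"
  using assms
proof (induction rule: finite_induct)
  case empty
  show ?case by (rule exI[of _ 1]) simp
next
  case (insert x S)
  then obtain D :: int where D: "0 < D" "\<And>y. y \<in> S \<Longrightarrow> \<exists>p::int. y = of_int p / of_int D"
    by auto
  have "x \<in> \<rat>" using insert.prems by simp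
  then obtain a b :: int where ab: "0 < b" "x = of_int a / of_int b"
    by (rule Rats_cases') auto
  have "\<exists>p::int. y = of_int p / of_int (D * b)" if "y \<in> insert x S" for y
  proof (cases "y = x")
    case True
    then have "y = of_int (D * a) / of_int (D * b)" using ab D(1) by simp
    then show ?thesis by blast
  next
    case False
    then obtain p :: int where "y = of_int p / of_int D" using D(2) \<open>y \<in> insert x S\<close> by blast
    then have "y = of_int (p * b) / of_int (D * b)" using ab(1) by simp
    then show ?thesis by blast
  qed
  then show ?case using D(1) ab(1) by (intro exI[of _ "D * b"]) simp
qed

context discounted_game
begin

section \<open>Value iteration\<close>

definition bellman_step :: "'v set \<Rightarrow> ('v \<Rightarrow> real) \<Rightarrow> 'v \<Rightarrow> real" where
  "bellman_step Z F u = (if u \<in> Z then Min ((\<lambda>j. wt P1 u j + d * F j) ` {j. (u, j) \<in> edges A})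
    else Max ((\<lambda>j. wt P1 u j + d * F j) ` {j. (u, j) \<in> edges A}))"

lemma bellman_step_bound:
  assumes "(u, j) \<in> edges A"
  shows "if u \<in> Z then bellman_step Z F u \<le> wt P1 u j + d * F j else wt P1 u j + d * F j \<le> bellman_step Z F u"
  using assms finite_succ[of u] by (auto simp: bellman_step_def intro!: Min_le Max_ge)

lemma bellman_step_attained:
  assumes "u \<in> verts A"
  shows "\<exists>j. (u, j) \<in> edges A \<and> bellman_step Z F u = wt P1 u j + d * F j"
proof -
  have "(\<lambda>j. wt P1 u j + d * F j) ` {j. (u, j) \<in> edges A} \<noteq> {}" using ex_edge[OF assms] by blast
  from Min_in[OF _ this] Max_in[OF _ this] show ?thesis
    using finite_succ[of u] by (cases "u \<in> Z") (auto simp: bellman_step_def)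
qed

text \<open>The contraction property: the successor that is optimal for one argument is also
  available for the other, where it costs at most \<open>d * c\<close> more or less.\<close>

lemma bellman_step_lipschitz:
  assumes u: "u \<in> verts A" and c: "\<And>j. j \<in> verts A \<Longrightarrow> \<bar>F j - G j\<bar> \<le> c"
  shows "\<bar>bellman_step Z F u - bellman_step Z G u\<bar> \<le> d * c"
proof -
  have dc: "d * F j \<le> d * G j + d * c" "d * G j \<le> d * F j + d * c" if "(u, j) \<in> edges A" for j
  proof -
    have "F j \<le> G j + c" "G j \<le> F j + c" using c edge_verts[OF that] by (auto simp: abs_le_iff algebra_simps)
    then show "d * F j \<le> d * G j + d * c" "d * G j \<le> d * F j + d * c"
      using d_pos by (simp_all flip: distrib_left)
  qed
  obtain j where j: "(u, j) \<in> edges A" "bellman_step Z F u = wt P1 u j + d * F j"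
    using bellman_step_attained[OF u] by blast
  obtain k where k: "(u, k) \<in> edges A" "bellman_step Z G u = wt P1 u k + d * G k"
    using bellman_step_attained[OF u] by blast
  show ?thesis
    using j k dc[OF j(1)] dc[OF k(1)] bellman_step_bound[where Z = Z and F = G, OF j(1)] bellman_step_bound[where Z = Z and F = F, OF k(1)]
    by (auto simp: abs_le_iff split: if_splits)
qed

text \<open>Value iteration from 0. By contraction, consecutive iterates differ by at most
  \<open>d ^ n * W\<close>, so they converge at each vertex; the bounds along edges pass to the
  limit.\<close>

lemma ex_bellman: "\<exists>F. bellman Z F"
proof -
  define v where "v n = (bellman_step Z ^^ n) (\<lambda>_. 0)" for n
  have v: "v 0 = (\<lambda>_. 0)" "v (Suc n) = bellman_step Z (v n)" for n
    by (simp_all add: v_def)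
  have diff: "\<bar>v (Suc n) u - v n u\<bar> \<le> d ^ n * W" if "u \<in> verts A" for n u
    using that
  proof (induction n arbitrary: u)
    case 0
    then show ?case using bellman_step_attained[where Z = Z and F = "v 0", OF 0] wt_bound by (auto simp: v)
  next
    case (Suc n)
    then show ?case
      using bellman_step_lipschitz[where Z = Z, OF Suc.prems Suc.IH] by (simp add: v mult.assoc)
  qed
  \<comment> \<open>The series telescopes to the limit of the iterates because the first iterate is
    0.\<close>
  define F where "F u = (\<Sum>n. v (Suc n) u - v n u)" for u
  have lim: "(\<lambda>n. v n u) \<longlonglongrightarrow> F u" if "u \<in> verts A" for u
  proof -
    have "summable (\<lambda>n. v (Suc n) u - v n u)"
      using diff[OF that] by (intro summable_comparison_test'[OF summable_W, of 0]) simp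
    moreover have "(\<Sum>i<n. v (Suc i) u - v i u) = v n u" for n
      using sum_lessThan_telescope[of "\<lambda>i. v i u" n] by (simp add: v(1))
    ultimately show ?thesis using summable_LIMSEQ unfolding F_def by fastforce
  qed
  have lim_edge: "(\<lambda>n. wt P1 u j + d * v n j) \<longlonglongrightarrow> wt P1 u j + d * F j" if "(u, j) \<in> edges A" for u j
    using edge_verts[OF that] by (intro tendsto_intros lim) simp
  have "bellman Z F"
    unfolding bellman_def
  proof (intro ballI conjI allI impI)
    fix u j assume u: "u \<in> verts A" and uj: "(u, j) \<in> edges A"
    show "if u \<in> Z then F u \<le> wt P1 u j + d * F j else wt P1 u j + d * F j \<le> F u"
      using LIMSEQ_le[OF LIMSEQ_Suc[OF lim[OF u]] lim_edge[OF uj]] LIMSEQ_le[OF lim_edge[OF uj] LIMSEQ_Suc[OF lim[OF u]]]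
        bellman_step_bound[where Z = Z, OF uj] by (auto simp: v)
  next
    fix u assume u: "u \<in> verts A"
    show "\<exists>j. (u, j) \<in> edges A \<and> F u = wt P1 u j + d * F j"
    proof (rule ccontr)
      assume "\<not> ?thesis"
      then have ne: "F u - (wt P1 u j + d * F j) \<noteq> 0" if "(u, j) \<in> edges A" for j using that by auto
      \<comment> \<open>Attainment survives the limit because only finitely many edges leave
        \<open>u\<close>: otherwise all of them would fail at a common iterate, although one of them
        attains its value.\<close>
      have "\<forall>\<^sub>F n in sequentially. v (Suc n) u - (wt P1 u j + d * v n j) \<noteq> 0" if "(u, j) \<in> edges A" for j
        using tendsto_diff[OF LIMSEQ_Suc[OF lim[OF u]] lim_edge[OF that]] ne[OF that]
        by (rule tendsto_imp_eventually_ne)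
      then have "\<forall>\<^sub>F n in sequentially. \<forall>j\<in>{j. (u, j) \<in> edges A}. v (Suc n) u - (wt P1 u j + d * v n j) \<noteq> 0"
        by (intro eventually_ball_finite finite_succ) simp
      then obtain n where "\<forall>j\<in>{j. (u, j) \<in> edges A}. v (Suc n) u - (wt P1 u j + d * v n j) \<noteq> 0"
        using eventually_happens'[OF sequentially_bot] by blast
      moreover obtain j where "(u, j) \<in> edges A" "v (Suc n) u = wt P1 u j + d * v n j"
        using bellman_step_attained[where Z = Z and F = "v n", OF u] by (auto simp: v)
      ultimately show False by (metis eq_iff_diff_eq_0 mem_Collect_eq)
    qed
  qed
  then show ?thesis by blast
qed

text \<open>Optimal successors lead into a cycle, on which the equations can be solved explicitly.\<close>

lemma bellman_rational:
  assumes F: "bellman Z F" and d: "d \<in> \<rat>" and u: "u \<in> verts A"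
  shows "F u \<in> \<rat>"
proof -
  obtain s where s: "\<And>u. u \<in> verts A \<Longrightarrow> (u, s u) \<in> edges A"
    "\<And>u. u \<in> verts A \<Longrightarrow> F u = wt P1 u (s u) + d * F (s u)"
    using bellman_succ[OF F] by blast
  define x where "x k = (s ^^ k) u" for k
  have xV: "x k \<in> verts A" for k
    using s(1) edge_verts u by (induction k) (auto simp: x_def)
  have "\<exists>q\<in>\<rat>. F (x i) = q + d ^ m * F (x (i + m))" for i m
  proof (induction m)
    case (Suc m)
    then obtain q where q: "q \<in> \<rat>" "F (x i) = q + d ^ m * F (x (i + m))" by blast
    have "F (x (i + m)) = wt P1 (x (i + m)) (x (i + Suc m)) + d * F (x (i + Suc m))"
      using s(2)[OF xV] by (simp add: x_def)
    then have "F (x i) = (q + d ^ m * wt P1 (x (i + m)) (x (i + Suc m))) + d ^ Suc m * F (x (i + Suc m))"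
      using q(2) by (simp add: algebra_simps)
    moreover have "q + d ^ m * wt P1 (x (i + m)) (x (i + Suc m)) \<in> \<rat>"
      using q(1) d by (simp add: wt_def)
    ultimately show ?case by blast
  qed (auto intro: bexI[of _ 0])
  note unroll = this
  have "\<not> inj x"
  proof
    assume "inj x"
    moreover have "finite (range x)" using xV by (intro finite_subset[OF _ finite_verts]) auto
    ultimately show False using finite_imageD by blast
  qed
  then obtain i j where ij: "i < j" "x i = x j"
    unfolding inj_def by (metis linorder_neqE_nat)
  define m where "m = j - i"
  have m: "0 < m" "i + m = j" using ij(1) by (simp_all add: m_def)
  obtain q where q: "q \<in> \<rat>" "F (x i) = q + d ^ m * F (x i)"
    using unroll[of i m] m ij by auto
  have dm: "d ^ m < 1" using d_pos d_less_1 m(1) by (simp add: power_Suc_less_one power_less_one_iff)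
  then have "F (x i) = q / (1 - d ^ m)" using q(2) by (simp add: field_simps)
  then have "F (x i) \<in> \<rat>" using q(1) d by simp
  moreover obtain r where "r \<in> \<rat>" "F (x 0) = r + d ^ i * F (x i)"
    using unroll[of 0 i] by auto
  ultimately have "F (x 0) \<in> \<rat>" using d by simp
  then show ?thesis by (simp add: x_def)
qed

lemma power_d_small:
  assumes "0 < e" shows "\<exists>N. K * d ^ N \<le> e"
proof -
  have "(\<lambda>n. K * d ^ n) \<longlonglongrightarrow> K * 0"
    using d_pos d_less_1 by (intro tendsto_mult_left LIMSEQ_power_zero) simp
  then have "\<forall>\<^sub>F n in sequentially. K * d ^ n < e"
    using assms by (intro order_tendstoD(2)) simp_all
  then show ?thesis using eventually_happens'[OF sequentially_bot] less_imp_le by blast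
qed

end

section \<open>The decision procedure\<close>

type_synonym coded_edge = "(nat \<times> nat) \<times> (int \<times> int)"

text \<open>A fold, so that computability is immediate. For a repeated key the last entry wins, and
  a missing key has value 0.\<close>

definition lookup :: "(nat \<times> int) list \<Rightarrow> nat \<Rightarrow> int" where
  "lookup P u = foldl (\<lambda>r q. if fst q = u then snd q else r) 0 P"

text \<open>The Bellman equations for \<open>lookup P u / D\<close> with discount factor
  \<open>a / b\<close>, multiplied by \<open>b * D\<close>.\<close>

definition solves :: "nat list \<Rightarrow> int \<Rightarrow> int \<Rightarrow> int \<Rightarrow> (nat \<times> int) list \<Rightarrow> nat list \<Rightarrow> coded_edge list \<Rightarrow> bool" where
  "solves Z a b D P U E \<longleftrightarrow>
    list_all (\<lambda>u. list_ex (\<lambda>e. fst (fst e) = u \<and>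
      b * lookup P u = b * D * snd (snd e) + a * lookup P (snd (fst e))) E) U \<and>
    list_all (\<lambda>e. if list_ex (\<lambda>z. z = fst (fst e)) Z
      then b * lookup P (fst (fst e)) \<le> b * D * snd (snd e) + a * lookup P (snd (fst e))
      else b * D * snd (snd e) + a * lookup P (snd (fst e)) \<le> b * lookup P (fst (fst e))) E"

text \<open>
  To stay within the integers, payoffs at distance \<open>n\<close> from the tails are multiplied by \<open>b ^ n\<close>, where
  \<open>d = a / b\<close>, and those of Player 1 also by a common denominator \<open>D\<close> of the values of the tails.
\<close>

definition scaled_extend :: "int \<Rightarrow> int \<Rightarrow> int \<Rightarrow> coded_edge \<Rightarrow> int \<times> int \<Rightarrow> int \<times> int" where
  "scaled_extend a D B e q = (B * D * snd (snd e) + a * fst q, B * fst (snd e) + a * snd q)"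

text \<open>Each payoff pair stays attached to its edge, because the domination test has to find a
  pair on every edge of Player 1.\<close>

definition images :: "int \<Rightarrow> int \<Rightarrow> int \<Rightarrow> coded_edge list \<Rightarrow> (nat \<times> int \<times> int) list
    \<Rightarrow> (coded_edge \<times> int \<times> int) list" where
  "images a D B E S = concat (map (\<lambda>e. map (\<lambda>s. (e, scaled_extend a D B e (snd s)))
    (filter (\<lambda>s. fst s = snd (fst e)) S)) E)"

definition undominated :: "bool \<Rightarrow> nat list \<Rightarrow> coded_edge list \<Rightarrow> (coded_edge \<times> int \<times> int) list
    \<Rightarrow> (nat \<times> int \<times> int) list" where
  "undominated adv V1 E I = map (\<lambda>i. (fst (fst (fst i)), snd i))
    (filter (\<lambda>i. list_ex (\<lambda>z. z = fst (fst (fst i))) V1 \<longrightarrow>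
      list_all (\<lambda>e. fst (fst e) = fst (fst (fst i)) \<longrightarrow>
        list_ex (\<lambda>k. fst k = e \<and> dominated adv (snd k) (snd i)) I) E) I)"

definition table :: "bool \<Rightarrow> int \<Rightarrow> int \<Rightarrow> int \<Rightarrow> (nat \<times> int) list \<Rightarrow> (nat \<times> int) list
    \<Rightarrow> nat list \<Rightarrow> nat list \<Rightarrow> coded_edge list \<Rightarrow> nat \<Rightarrow> (nat \<times> int \<times> int) list" where
  "table adv a b D P Q V0 V1 E n =
    rec_nat (map (\<lambda>u. (u, lookup P u, 0)) (V0 @ V1) @ map (\<lambda>u. (u, lookup Q u, 0)) (V0 @ V1))
      (\<lambda>k S. undominated adv V1 E (images a D (b ^ Suc k) E S)) n"

type_synonym coded_instance =
  "nat list \<times> nat list \<times> coded_edge list \<times> (int \<times> int) \<times> nat \<times> (int \<times> int) \<times> (int \<times> int)"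

text \<open>In this order: a common denominator, the numerators of the cooperative and of the
  zero-sum values, a bound on the weights, and the depth.\<close>

type_synonym certificate = "int \<times> (nat \<times> int) list \<times> (nat \<times> int) list \<times> int \<times> nat"

text \<open>The last conjunct is \<open>K * d ^ N \<le> e / e'\<close> without denominators, since
  \<open>K\<close> equals \<open>W * b / (b - a)\<close> for the discount factor
  \<open>a / b\<close>.\<close>

definition valid :: "coded_instance \<Rightarrow> certificate \<Rightarrow> bool" where
  "valid x y = (case x of (V0, V1, E, (a, b), v, (e, e'), c) \<Rightarrow> case y of (D, P, Q, W, N) \<Rightarrow>
    0 < D \<and> solves [] a b D P (V0 @ V1) E \<and> solves V0 a b D Q (V0 @ V1) E \<and>
    list_all (\<lambda>e. - W \<le> fst (snd e) \<and> fst (snd e) \<le> W \<and> - W \<le> snd (snd e) \<and> snd (snd e) \<le> W) E \<and>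
    e' * (W * b * a ^ N) \<le> e * ((b - a) * b ^ N))"

definition answer :: "bool \<Rightarrow> coded_instance \<Rightarrow> certificate \<Rightarrow> bool" where
  "answer adv x y = (case x of (V0, V1, E, (a, b), v, e, (c, c')) \<Rightarrow> case y of (D, P, Q, W, N) \<Rightarrow>
    list_ex (\<lambda>s. fst s = v \<and> c * b ^ N \<le> c' * snd (snd s)) (table adv a b D P Q V0 V1 E N))"

section \<open>Computability of the procedure\<close>

lemma computable_lookup [computable_intros]:
  assumes "computable P" "computable u" shows "computable (\<lambda>x. lookup (P x) (u x))"
  unfolding lookup_def by (intro computable_intros assms[THEN computable_comp])

lemma computable_solves [computable_intros]:
  assumes "computable Z" "computable a" "computable b" "computable D" "computable P" "computable U" "computable E"
  shows "computable (\<lambda>x. solves (Z x) (a x) (b x) (D x) (P x) (U x) (E x))"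
  unfolding solves_def by (intro computable_intros assms[THEN computable_comp])

lemma computable_scaled_extend [computable_intros]:
  assumes "computable a" "computable D" "computable B" "computable e" "computable q"
  shows "computable (\<lambda>x. scaled_extend (a x) (D x) (B x) (e x) (q x))"
  unfolding scaled_extend_def by (intro computable_intros assms[THEN computable_comp])

lemma computable_images [computable_intros]:
  assumes "computable a" "computable D" "computable B" "computable E" "computable S"
  shows "computable (\<lambda>x. images (a x) (D x) (B x) (E x) (S x))"
  unfolding images_def by (intro computable_intros assms[THEN computable_comp])

lemma computable_dominated [computable_intros]:
  fixes p q :: "'a::encodable \<Rightarrow> int \<times> int"
  assumes "computable p" "computable q"
  shows "computable (\<lambda>x. dominated adv (p x) (q x))"
  unfolding dominated_def by (intro computable_intros assms[THEN computable_comp])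

lemma computable_undominated [computable_intros]:
  assumes "computable V1" "computable E" "computable I"
  shows "computable (\<lambda>x. undominated adv (V1 x) (E x) (I x))"
  unfolding undominated_def by (intro computable_intros assms[THEN computable_comp])

lemma computable_table [computable_intros]:
  assumes "computable a" "computable b" "computable D" "computable P" "computable Q"
    "computable V0" "computable V1" "computable E" "computable n"
  shows "computable (\<lambda>x. table adv (a x) (b x) (D x) (P x) (Q x) (V0 x) (V1 x) (E x) (n x))"
  unfolding table_def by (intro computable_intros assms[THEN computable_comp])

lemma computable_valid: "computable (\<lambda>p. valid (fst p) (snd p))"
  unfolding valid_def case_prod_unfold by (intro computable_intros)

lemma computable_answer: "computable (\<lambda>p. answer adv (fst p) (snd p))"
  unfolding answer_def case_prod_unfold by (intro computable_intros)

text \<open>The search runs through all numbers, so each must code a certificate. This holds because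
  certificates are built only from types whose codes are bijective.\<close>

lemma surj_enc_certificate: "surj (enc :: certificate \<Rightarrow> nat)"
  by (intro surj_enc_prod surj_enc_list surj_enc_nat surj_enc_int)

lemma lookup_map:
  assumes "u \<in> set U" shows "lookup (map (\<lambda>u. (u, p u)) U) u = p u"
proof -
  have *: "foldl (\<lambda>r q. if fst q = u then snd q else r) r (map (\<lambda>u. (u, p u)) U) = (if u \<in> set U then p u else r)" for r
    by (induction U arbitrary: r) auto
  show ?thesis using assms unfolding lookup_def * by simp
qed

lemma dominated_divide:
  fixes r s :: real
  assumes "0 < r" "0 < s"
  shows "dominated adv (of_int x / r, of_int y / s) (of_int x' / r, of_int y' / s) \<longleftrightarrow>
    dominated adv (x, y) (x', y')"
  using assms by (auto simp: dominated_def divide_less_cancel divide_le_cancel)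

section \<open>The integer computation compared with the real game\<close>

locale coded_game =
  fixes A :: "nat arena" and V0 V1 :: "nat list" and E :: "coded_edge list" and a b :: int
  assumes arena: "is_arena A" and V0: "set V0 = owned A P0" and V1: "set V1 = owned A P1"
    and E: "set E = (\<lambda>e. (e, weight A P0 e, weight A P1 e)) ` edges A"
    and a: "0 < a" and ab: "a < b"
begin

definition d :: real where "d = of_int a / of_int b"

lemma d_pos: "0 < d" and d_less_1: "d < 1"
  using a ab by (simp_all add: d_def)

lemma ex_E: "(\<exists>e\<in>set E. R e) \<longleftrightarrow> (\<exists>u j. (u, j) \<in> edges A \<and> R ((u, j), weight A P0 (u, j), weight A P1 (u, j)))"
  unfolding E by auto

lemma all_E: "(\<forall>e\<in>set E. R e) \<longleftrightarrow> (\<forall>u j. (u, j) \<in> edges A \<longrightarrow> R ((u, j), weight A P0 (u, j), weight A P1 (u, j)))"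
  unfolding E by auto

lemma set_verts: "set (V0 @ V1) = verts A"
  using arena V0 V1 by (auto simp: is_arena_def)

lemma discounted_gameI:
  assumes "\<And>e. e \<in> edges A \<Longrightarrow> \<bar>weight A P0 e\<bar> \<le> W" "\<And>e. e \<in> edges A \<Longrightarrow> \<bar>weight A P1 e\<bar> \<le> W"
  shows "discounted_game A d (of_int W)"
proof
  fix i e assume "e \<in> edges A"
  then have "\<bar>weight A i e\<bar> \<le> W" using assms by (cases i) auto
  then show "\<bar>real_of_int (weight A i e)\<bar> \<le> of_int W" by (metis of_int_abs of_int_le_iff)
qed (use arena d_pos d_less_1 in auto)

end

locale certified_game = coded_game +
  fixes D W :: int
  assumes D: "0 < D" 
    and W: "\<And>e. e \<in> edges A \<Longrightarrow> \<bar>weight A P0 e\<bar> \<le> W" "\<And>e. e \<in> edges A \<Longrightarrow> \<bar>weight A P1 e\<bar> \<le> W"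
begin

sublocale discounted_game A d "of_int W"
  using W by (rule discounted_gameI)

abbreviation unscaled :: "(nat \<times> int) list \<Rightarrow> nat \<Rightarrow> real" where
  "unscaled P u \<equiv> of_int (lookup P u) / of_int D"

text \<open>Multiplication by the positive number \<open>b * D\<close> preserves the order; the
  corresponding equation is obtained from the two inequalities.\<close>

lemma scaled_le:
  "b * x \<le> b * D * w + a * y \<longleftrightarrow> real_of_int x / of_int D \<le> of_int w + d * (of_int y / of_int D)"
  "b * D * w + a * y \<le> b * x \<longleftrightarrow> of_int w + d * (of_int y / of_int D) \<le> real_of_int x / of_int D"
proof -
  have pos: "0 < real_of_int b * of_int D" using a ab D by simp
  have l: "real_of_int (b * x) = of_int b * of_int D * (of_int x / of_int D)" using D by simp
  have r: "real_of_int (b * D * w + a * y) = of_int b * of_int D * (of_int w + d * (of_int y / of_int D))"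
    using D a ab by (simp add: d_def field_simps)
  show "b * x \<le> b * D * w + a * y \<longleftrightarrow> real_of_int x / of_int D \<le> of_int w + d * (of_int y / of_int D)"
    using l r mult_le_cancel_left_pos[OF pos] of_int_le_iff[where 'a = real] by metis
  show "b * D * w + a * y \<le> b * x \<longleftrightarrow> of_int w + d * (of_int y / of_int D) \<le> real_of_int x / of_int D"
    using l r mult_le_cancel_left_pos[OF pos] of_int_le_iff[where 'a = real] by metis
qed

lemma solves_iff:
  "solves Z a b D P (V0 @ V1) E \<longleftrightarrow> bellman (set Z) (unscaled P)"
proof -
  have eq: "b * x = b * D * w + a * y \<longleftrightarrow> real_of_int x / of_int D = of_int w + d * (of_int y / of_int D)"
    for x w y
    by (simp only: order.eq_iff[of "b * x"] order.eq_iff[of "real_of_int x / of_int D"] scaled_le)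
  have mem: "list_ex (\<lambda>z. z = u) Z \<longleftrightarrow> u \<in> set Z" for u
    by (auto simp: list_ex_iff)
  have "solves Z a b D P (V0 @ V1) E \<longleftrightarrow>
    (\<forall>u\<in>verts A. \<exists>j. (u, j) \<in> edges A \<and> unscaled P u = wt P1 u j + d * unscaled P j) \<and>
    (\<forall>u j. (u, j) \<in> edges A \<longrightarrow>
      (if u \<in> set Z then unscaled P u \<le> wt P1 u j + d * unscaled P j
        else wt P1 u j + d * unscaled P j \<le> unscaled P u))"
    unfolding solves_def list_all_iff list_ex_iff[of _ E] mem set_verts ex_E all_E eq scaled_le
    by (simp add: wt_def)
  also have "\<dots> \<longleftrightarrow> bellman (set Z) (unscaled P)"
    unfolding bellman_def using edge_verts by blast
  finally show ?thesis .
qed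

end

locale certified_solved_game = certified_game +
  fixes P Q :: "(nat \<times> int) list"
  assumes P: "bellman {} (unscaled P)" and Q: "bellman (owned A P0) (unscaled Q)"
begin

sublocale solved_game A d "of_int W" "unscaled P" "unscaled Q"
  using P Q by unfold_locales

definition unscale :: "nat \<Rightarrow> int \<times> int \<Rightarrow> real \<times> real" where
  "unscale n q = (of_int (fst q) / (of_int D * of_int b ^ n), of_int (snd q) / of_int b ^ n)"

text \<open>Multiplying \<open>w + (a / b) * x\<close> by \<open>b ^ Suc n\<close> turns the
  discounted part into \<open>a * (b ^ n * x)\<close>: the old scaled payoff only gains the factor
  \<open>a\<close>, and no division occurs.\<close>

lemma unscale_extend:
  assumes "(u, j) \<in> edges A"
  shows "unscale (Suc n) (scaled_extend a D (b ^ Suc n) ((u, j), weight A P0 (u, j), weight A P1 (u, j)) q)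
    = extend u j (unscale n q)"
proof -
  have "real_of_int b \<noteq> 0" "real_of_int D \<noteq> 0" using a ab D by auto
  then show ?thesis
    unfolding unscale_def scaled_extend_def extend_def wt_def by (simp add: d_def field_simps)
qed

text \<open>All pairs of one round share their positive scaling factors, so comparisons of integers,
  ties included, agree with those of the real payoffs.\<close>

lemma dominated_unscale: "dominated adv (unscale n q) (unscale n p) \<longleftrightarrow> dominated adv q p"
proof -
  have "0 < real_of_int D * of_int b ^ n" "0 < real_of_int b ^ n" using D a ab by simp_all
  from dominated_divide[OF this, of adv "fst q" "snd q" "fst p" "snd p"] show ?thesis
    by (simp add: unscale_def)
qed

lemma set_images:
  "(((u, j), w), p) \<in> set (images a D B E S) \<longleftrightarrow>
    ((u, j), w) \<in> set E \<and> (\<exists>q. (j, q) \<in> set S \<and> p = scaled_extend a D B ((u, j), w) q)"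
  by (force simp: images_def)

lemma table_Suc:
  "table adv a b D P Q V0 V1 E (Suc n) =
    undominated adv V1 E (images a D (b ^ Suc n) E (table adv a b D P Q V0 V1 E n))"
  by (simp add: table_def)

text \<open>A coded edge is determined by its endpoints, because \<open>E\<close> lists each edge
  with its weights. Hence testing coded edges amounts to quantifying over successors.\<close>

lemma set_undominated:
  fixes S and B :: int defines "I \<equiv> images a D B E S"
  shows "(u, p) \<in> set (undominated adv V1 E I) \<longleftrightarrow>
    (\<exists>j q. (u, j) \<in> edges A \<and> (j, q) \<in> set S \<and>
      p = scaled_extend a D B ((u, j), weight A P0 (u, j), weight A P1 (u, j)) q \<and>
      (u \<in> owned A P1 \<longrightarrow> (\<forall>j'. (u, j') \<in> edges A \<longrightarrow> (\<exists>q'. (j', q') \<in> set S \<and>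
        dominated adv (scaled_extend a D B ((u, j'), weight A P0 (u, j'), weight A P1 (u, j')) q') p))))"
    (is "_ \<longleftrightarrow> (\<exists>j q. _ \<and> _ \<and> _ \<and> ?dom)")
proof -
  define c where "c u j = ((u, j), weight A P0 (u, j), weight A P1 (u, j))" for u j
  have I: "(c u j, p) \<in> set I \<longleftrightarrow> (u, j) \<in> edges A \<and> (\<exists>q. (j, q) \<in> set S \<and> p = scaled_extend a D B (c u j) q)"
    for u j p
    unfolding I_def c_def by (subst set_images) (auto simp: E)
  have I_c: "\<exists>u j. fst i = c u j" if "i \<in> set I" for i
    using that by (auto simp: I_def images_def E c_def)
  have mem: "(u, p) \<in> set (undominated adv V1 E I) \<longleftrightarrow>
    (\<exists>e. (e, p) \<in> set I \<and> fst (fst e) = u \<and> (u \<in> owned A P1 \<longrightarrow>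
      (\<forall>e'\<in>set E. fst (fst e') = u \<longrightarrow> (\<exists>k\<in>set I. fst k = e' \<and> dominated adv (snd k) p))))"
  proof -
    have "list_ex (\<lambda>z. z = y) V1 \<longleftrightarrow> y \<in> owned A P1" for y
      using V1 by (auto simp: list_ex_iff)
    then have set_eq: "set (undominated adv V1 E I) = (\<lambda>i. (fst (fst (fst i)), snd i)) ` {i \<in> set I.
      fst (fst (fst i)) \<in> owned A P1 \<longrightarrow> (\<forall>e'\<in>set E. fst (fst e') = fst (fst (fst i)) \<longrightarrow>
        (\<exists>k\<in>set I. fst k = e' \<and> dominated adv (snd k) (snd i)))}"
      by (simp only: undominated_def set_map set_filter list_all_iff list_ex_iff[of _ I])
    have "(u, p) \<in> (\<lambda>i. (h (fst i), snd i)) ` {i \<in> set I. R (h (fst i)) (snd i)} \<longleftrightarrow>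
      (\<exists>e. (e, p) \<in> set I \<and> h e = u \<and> R u p)" for h R
      by force
    from this[of "\<lambda>e. fst (fst e)" "\<lambda>u p. u \<in> owned A P1 \<longrightarrow>
      (\<forall>e'\<in>set E. fst (fst e') = u \<longrightarrow> (\<exists>k\<in>set I. fst k = e' \<and> dominated adv (snd k) p))"]
    show ?thesis unfolding set_eq .
  qed
  have "(u, p) \<in> set (undominated adv V1 E I) \<longleftrightarrow>
    (\<exists>j. (c u j, p) \<in> set I \<and> (u \<in> owned A P1 \<longrightarrow>
      (\<forall>j'. (u, j') \<in> edges A \<longrightarrow> (\<exists>p'. (c u j', p') \<in> set I \<and> dominated adv p' p))))"
    (is "_ \<longleftrightarrow> ?R")
  proof
    assume "(u, p) \<in> set (undominated adv V1 E I)"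
    then obtain e where e: "(e, p) \<in> set I" "fst (fst e) = u"
      and dom: "u \<in> owned A P1 \<longrightarrow> (\<forall>e'\<in>set E. fst (fst e') = u \<longrightarrow>
        (\<exists>k\<in>set I. fst k = e' \<and> dominated adv (snd k) p))"
      unfolding mem by blast
    obtain j where j: "e = c u j" using I_c[OF e(1)] e(2) by (auto simp: c_def)
    have "\<exists>p'. (c u j', p') \<in> set I \<and> dominated adv p' p" if u: "u \<in> owned A P1" and uj: "(u, j') \<in> edges A" for j'
    proof -
      have "c u j' \<in> set E" "fst (fst (c u j')) = u" using uj by (auto simp: E c_def)
      then obtain k where "k \<in> set I" "fst k = c u j'" "dominated adv (snd k) p"
        using dom u by blast
      then show ?thesis by (metis prod.collapse)
    qed
    then show ?R using e(1) j by blast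
  next
    assume ?R
    then obtain j where j: "(c u j, p) \<in> set I"
      and dom: "u \<in> owned A P1 \<Longrightarrow> \<forall>j'. (u, j') \<in> edges A \<longrightarrow> (\<exists>p'. (c u j', p') \<in> set I \<and> dominated adv p' p)"
      by blast
    have "\<forall>e'\<in>set E. fst (fst e') = u \<longrightarrow> (\<exists>k\<in>set I. fst k = e' \<and> dominated adv (snd k) p)"
      if u: "u \<in> owned A P1"
    proof (intro ballI impI)
      fix e' assume "e' \<in> set E" "fst (fst e') = u"
      then obtain j' where j': "e' = c u j'" "(u, j') \<in> edges A" by (auto simp: E c_def)
      then obtain p' where "(c u j', p') \<in> set I" "dominated adv p' p" using dom[OF u] by blast
      then show "\<exists>k\<in>set I. fst k = e' \<and> dominated adv (snd k) p" using j'(1) by force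
    qed
    then show "(u, p) \<in> set (undominated adv V1 E I)"
      unfolding mem using j by (intro exI[of _ "c u j"]) (simp add: c_def)
  qed
  also have "\<dots> \<longleftrightarrow> (\<exists>j. (c u j, p) \<in> set I \<and> ?dom)"
  proof -
    have "(\<exists>p'. (c u j', p') \<in> set I \<and> dominated adv p' p) \<longleftrightarrow>
      (\<exists>q'. (j', q') \<in> set S \<and> dominated adv (scaled_extend a D B (c u j') q') p)"
      if "(u, j') \<in> edges A" for j'
      unfolding I using that by (simp del: split_paired_Ex) metis
    then show ?thesis unfolding c_def by (simp cong: imp_cong)
  qed
  also have "\<dots> \<longleftrightarrow> (\<exists>j q. (u, j) \<in> edges A \<and> (j, q) \<in> set S \<and> p = scaled_extend a D B (c u j) q \<and> ?dom)"
  proof -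
    have "(\<exists>j. (c u j, p) \<in> set I \<and> C) \<longleftrightarrow>
      (\<exists>j q. (u, j) \<in> edges A \<and> (j, q) \<in> set S \<and> p = scaled_extend a D B (c u j) q \<and> C)" for C
      unfolding I by blast
    then show ?thesis .
  qed
  finally show ?thesis unfolding c_def .
qed

text \<open>The table is exact: each rule of \<open>pairs\<close> commutes with unscaling. In
  particular the sets of pairs are finite and can be searched for a threshold.\<close>

lemma pairs_table:
  assumes "u \<in> verts A"
  shows "pairs adv n u = unscale n ` {p. (u, p) \<in> set (table adv a b D P Q V0 V1 E n)}"
  using assms
proof (induction n arbitrary: u)
  case 0
  then have "{p. (u, p) \<in> set (table adv a b D P Q V0 V1 E 0)} = {(lookup P u, 0), (lookup Q u, 0)}"
    using set_verts by (auto simp: table_def)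
  then show ?case by (simp add: unscale_def)
next
  case (Suc n)
  define S where "S = table adv a b D P Q V0 V1 E n"
  define g where "g j = scaled_extend a D (b ^ Suc n) ((u, j), weight A P0 (u, j), weight A P1 (u, j))" for j
  have IH: "pairs adv n j = unscale n ` {q. (j, q) \<in> set S}" if "(u, j) \<in> edges A" for j
    unfolding S_def by (rule Suc.IH) (use edge_verts[OF that] in blast)
  have ex_IH: "(\<exists>q\<in>pairs adv n j. R q) \<longleftrightarrow> (\<exists>q. (j, q) \<in> set S \<and> R (unscale n q))"
    if "(u, j) \<in> edges A" for j R
    unfolding IH[OF that] by blast
  have g: "extend u j (unscale n q) = unscale (Suc n) (g j q)" if "(u, j) \<in> edges A" for j q
    using unscale_extend[OF that] by (simp add: g_def)
  have dom: "(\<exists>q'\<in>pairs adv n j'. dominated adv (extend u j' q') (extend u j (unscale n q))) \<longleftrightarrow>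
      (\<exists>q'. (j', q') \<in> set S \<and> dominated adv (g j' q') (g j q))"
    if "(u, j) \<in> edges A" "(u, j') \<in> edges A" for j j' q
    unfolding ex_IH[OF that(2)] g[OF that(1)] g[OF that(2)] dominated_unscale ..
  have table: "{p. (u, p) \<in> set (table adv a b D P Q V0 V1 E (Suc n))} =
    {g j q | j q. (u, j) \<in> edges A \<and> (j, q) \<in> set S \<and> (u \<in> owned A P1 \<longrightarrow>
      (\<forall>j'. (u, j') \<in> edges A \<longrightarrow> (\<exists>q'. (j', q') \<in> set S \<and> dominated adv (g j' q') (g j q))))}"
    unfolding table_Suc set_undominated S_def[symmetric] g_def by blast
  have "pairs adv (Suc n) u = {p. \<exists>j. (u, j) \<in> edges A \<and> (\<exists>q\<in>pairs adv n j. p = extend u j q \<and>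
    (u \<in> owned A P1 \<longrightarrow> (\<forall>j'. (u, j') \<in> edges A \<longrightarrow>
      (\<exists>q'\<in>pairs adv n j'. dominated adv (extend u j' q') (extend u j q)))))}"
    unfolding pairs.simps by blast
  also have "\<dots> = {unscale (Suc n) (g j q) | j q. (u, j) \<in> edges A \<and> (j, q) \<in> set S \<and> (u \<in> owned A P1 \<longrightarrow>
      (\<forall>j'. (u, j') \<in> edges A \<longrightarrow> (\<exists>q'. (j', q') \<in> set S \<and> dominated adv (g j' q') (g j q))))}"
    using ex_IH dom g by (intro Collect_cong) (simp cong: conj_cong imp_cong, blast)
  also have "\<dots> = unscale (Suc n) ` {p. (u, p) \<in> set (table adv a b D P Q V0 V1 E (Suc n))}"
    unfolding table by blast
  finally show ?case .
qed

lemma answer_iff: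
  assumes v: "v \<in> verts A" and c': "0 < c'"
  shows "answer adv (V0, V1, E, (a, b), v, e, (c, c')) (D, P, Q, W', N) \<longleftrightarrow>
    (\<exists>p\<in>pairs adv N v. of_int c / of_int c' \<le> snd p)"
proof -
  have *: "c * b ^ N \<le> c' * y \<longleftrightarrow> real_of_int c / of_int c' \<le> of_int y / of_int b ^ N" for y
  proof -
    have "0 < real_of_int b ^ N" "0 < real_of_int c'" using a ab c' by simp_all
    then have "real_of_int c / of_int c' \<le> of_int y / of_int b ^ N \<longleftrightarrow>
      real_of_int (c * b ^ N) \<le> real_of_int (c' * y)"
      by (simp add: field_simps)
    then show ?thesis unfolding of_int_le_iff by simp
  qed
  have "answer adv (V0, V1, E, (a, b), v, e, (c, c')) (D, P, Q, W', N) \<longleftrightarrow>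
    (\<exists>q. (v, q) \<in> set (table adv a b D P Q V0 V1 E N) \<and> of_int c / of_int c' \<le> snd (unscale N q))"
    unfolding answer_def prod.case list_ex_iff * unscale_def by (metis fst_conv prod.collapse snd_conv)
  then show ?thesis unfolding pairs_table[OF v] by blast
qed

lemma error_iff:
  assumes "0 < e'"
  shows "e' * (W * b * a ^ N) \<le> e * ((b - a) * b ^ N) \<longleftrightarrow> K * d ^ N \<le> of_int e / of_int e'"
proof -
  have pos: "0 < real_of_int b ^ N" "0 < real_of_int e'" "0 < real_of_int b - of_int a" "0 < real_of_int b"
    using a ab assms by simp_all
  have "K * d ^ N = of_int W * of_int b * of_int a ^ N / ((of_int b - of_int a) * of_int b ^ N)"
    using pos unfolding K_def by (simp add: d_def power_divide field_simps)
  also have "\<dots> \<le> of_int e / of_int e' \<longleftrightarrow>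
    real_of_int (e' * (W * b * a ^ N)) \<le> real_of_int (e * ((b - a) * b ^ N))"
    using pos by (simp add: divide_le_eq le_divide_eq mult_ac)
  finally show ?thesis unfolding of_int_le_iff by simp
qed

end

section \<open>Existence of certificates and correctness of the answers\<close>

context coded_game
begin

text \<open>This guarantees termination of the search. Value iteration yields real solutions, their
  rationality yields a common denominator, and discounting yields a sufficient depth.\<close>

lemma ex_valid:
  assumes "0 < e" "0 < e'"
  shows "\<exists>y. valid (V0, V1, E, (a, b), v, (e, e'), c) y"
proof -
  define W where "W = Max ((\<lambda>x. \<bar>x\<bar>) ` (weight A P0 ` edges A \<union> weight A P1 ` edges A))"
  have fin: "finite (edges A)"
  proof -
    have "edges A = fst ` set E" unfolding E by (simp add: image_image)
    then show ?thesis by simp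
  qed
  have W_bound: "\<bar>weight A P0 x\<bar> \<le> W" "\<bar>weight A P1 x\<bar> \<le> W" if "x \<in> edges A" for x
    unfolding W_def using fin that by (auto intro!: Max_ge)
  interpret discounted_game A d "of_int W"
    using W_bound by (rule discounted_gameI)
  obtain M V where M: "bellman {} M" and V: "bellman (owned A P0) V"
    using ex_bellman by blast
  have "d \<in> \<rat>" by (simp add: d_def)
  then have "M ` verts A \<union> V ` verts A \<subseteq> \<rat>"
    using bellman_rational[OF M] bellman_rational[OF V] by auto
  from common_denominator[OF _ this] obtain D :: int where D: "0 < D"
    "\<And>x. x \<in> M ` verts A \<union> V ` verts A \<Longrightarrow> \<exists>p::int. x = of_int p / of_int D"
    using finite_verts by auto
  then have "\<exists>p::int. M u = of_int p / of_int D" "\<exists>p::int. V u = of_int p / of_int D" if "u \<in> verts A" for u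
    using that by auto
  then obtain m m' :: "nat \<Rightarrow> int" where m: "\<And>u. u \<in> verts A \<Longrightarrow> M u = of_int (m u) / of_int D"
    "\<And>u. u \<in> verts A \<Longrightarrow> V u = of_int (m' u) / of_int D"
    by metis
  \<comment> \<open>The lists range over all vertices, so \<open>lookup\<close> never falls back to
    its default there.\<close>
  define P Q where "P = map (\<lambda>u. (u, m u)) (V0 @ V1)" and "Q = map (\<lambda>u. (u, m' u)) (V0 @ V1)"
  interpret certified_game A V0 V1 E a b D W
    using D(1) W_bound by unfold_locales
  have lookup: "unscaled P u = M u" "unscaled Q u = V u" if "u \<in> verts A" for u
  proof -
    have "u \<in> set (V0 @ V1)" unfolding set_verts by (rule that)
    then show "unscaled P u = M u" "unscaled Q u = V u"
      using m[OF that] by (simp_all only: P_def Q_def lookup_map)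
  qed
  have P: "bellman {} (unscaled P)" and Q: "bellman (owned A P0) (unscaled Q)"
    using M V lookup edge_verts unfolding bellman_def by (simp_all cong: conj_cong imp_cong)
  interpret certified_solved_game A V0 V1 E a b D W P Q
    using P Q by unfold_locales
  have "0 < real_of_int e / of_int e'" using assms by simp
  then obtain N where "K * d ^ N \<le> of_int e / of_int e'" using power_d_small by blast
  then have "e' * (W * b * a ^ N) \<le> e * ((b - a) * b ^ N)" using error_iff[OF assms(2)] by simp
  moreover have "solves [] a b D P (V0 @ V1) E" "solves V0 a b D Q (V0 @ V1) E"
    using P Q by (simp_all add: solves_iff V0)
  moreover have "list_all (\<lambda>e. - W \<le> fst (snd e) \<and> fst (snd e) \<le> W \<and> - W \<le> snd (snd e) \<and> snd (snd e) \<le> W) E"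
    unfolding list_all_iff all_E using W_bound by (auto simp: abs_le_iff minus_le_iff)
  ultimately have "valid (V0, V1, E, (a, b), v, (e, e'), c) (D, P, Q, W, N)"
    using D(1) by (simp add: valid_def)
  then show ?thesis by blast
qed

text \<open>Holds for every valid certificate. With the threshold \<open>c / c'\<close> on the
  second components, completeness and soundness of the pairs each lose at most
  \<open>K * d ^ N\<close>, which is at most the gap.\<close>

lemma valid_answer:
  fixes adv :: bool
  assumes valid: "valid (V0, V1, E, (a, b), v, (e, e'), (c, c')) y" and v: "v \<in> verts A"
    and e': "0 < e'" and c': "0 < c'"
  defines "VAL \<equiv> if adv then ASV A d v else CSV A d v"
  shows "of_int c / of_int c' + of_int e / of_int e' < VAL \<Longrightarrow> answer adv (V0, V1, E, (a, b), v, (e, e'), (c, c')) y"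
    and "VAL < of_int c / of_int c' - of_int e / of_int e' \<Longrightarrow> \<not> answer adv (V0, V1, E, (a, b), v, (e, e'), (c, c')) y"
proof -
  obtain D P Q W N where y: "y = (D, P, Q, W, N)" by (rule prod_cases5)
  have D: "0 < D" and solves: "solves [] a b D P (V0 @ V1) E" "solves V0 a b D Q (V0 @ V1) E"
    and bounds: "list_all (\<lambda>e. - W \<le> fst (snd e) \<and> fst (snd e) \<le> W \<and> - W \<le> snd (snd e) \<and> snd (snd e) \<le> W) E"
    and N: "e' * (W * b * a ^ N) \<le> e * ((b - a) * b ^ N)"
    using valid by (simp_all add: valid_def y)
  have W_bound: "\<bar>weight A P0 x\<bar> \<le> W" "\<bar>weight A P1 x\<bar> \<le> W" if "x \<in> edges A" for x
    using bounds that unfolding list_all_iff all_E by (cases x, auto simp: abs_le_iff minus_le_iff)+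
  interpret certified_game A V0 V1 E a b D W
    using D W_bound by unfold_locales
  interpret certified_solved_game A V0 V1 E a b D W P Q
    using solves by unfold_locales (simp_all add: solves_iff V0)
  have VAL: "VAL = stackelberg_value adv v" by (simp add: VAL_def stackelberg_value_def)
  have err: "K * d ^ N \<le> of_int e / of_int e'" using N error_iff[OF e'] by simp
  note answer = answer_iff[OF v c', of adv "(e, e')" c W N, folded y]
  show "answer adv (V0, V1, E, (a, b), v, (e, e'), (c, c')) y"
    if VAL_greater: "of_int c / of_int c' + of_int e / of_int e' < VAL"
  proof -
    obtain p where "p \<in> pairs adv N v" "of_int c / of_int c' + of_int e / of_int e' - K * d ^ N \<le> snd p"
      using less_stackelberg_value[OF v VAL_greater[unfolded VAL]] by blast
    with err show ?thesis unfolding answer by (intro bexI[of _ p]) linarith+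
  qed
  show "\<not> answer adv (V0, V1, E, (a, b), v, (e, e'), (c, c')) y"
    if VAL_less: "VAL < of_int c / of_int c' - of_int e / of_int e'"
  proof
    assume "answer adv (V0, V1, E, (a, b), v, (e, e'), (c, c')) y"
    then obtain p where "p \<in> pairs adv N v" "of_int c / of_int c' \<le> snd p"
      unfolding answer by blast
    with le_stackelberg_value[OF v, of p adv N] err VAL_less show False unfolding VAL by linarith
  qed
qed

end

text \<open>Turns the code of an instance into the code of the corresponding \<^typ>\<open>coded_instance\<close>.\<close>

definition recode :: "nat \<Rightarrow> nat" where
  "recode n = (let hd = (\<lambda>l. fst (prod_decode (l - 1))); tl = (\<lambda>l. snd (prod_decode (l - 1))); g = hd n
    in prod_encode (hd g, prod_encode (hd (tl g), prod_encode (hd (tl (tl g)),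
      prod_encode (hd (tl n), prod_encode (hd (tl (tl n)),
        prod_encode (hd (tl (tl (tl n))), hd (tl (tl (tl (tl n)))))))))))"

lemma total_recursive_recode: "total_recursive recode"
proof -
  have dec: "computable (\<lambda>x. prod_decode (f x))" if "computable f" for f :: "nat \<Rightarrow> nat"
    by (rule computable_cast[OF that]) (simp add: enc_nat_def enc_prod_def)
  have encode: "computable (\<lambda>x. prod_encode (f x, g x))" if "computable f" "computable g" for f g :: "nat \<Rightarrow> nat"
    by (rule computable_cast[OF computable_Pair[OF that]]) (simp add: enc_nat_def enc_prod_def)
  have "computable recode"
    unfolding recode_def Let_def by (intro encode dec computable_intros)
  then show ?thesis by (simp add: computable_nat_iff)
qed

lemma enc_nat_list: "enc (xs :: nat list) = list_encode xs"
  by (simp add: enc_list_def enc_nat_def[abs_def])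

theorem theorem17:
  fixes VAL :: "nat arena \<Rightarrow> real \<Rightarrow> nat \<Rightarrow> real"
  assumes "VAL \<in> {CSV, ASV}"
  shows "\<exists>f. partial_recursive f \<and>
    (\<forall>(A :: nat arena) (d :: rat) v (\<epsilon> :: rat) (c :: rat).
       is_arena A \<and> 0 < d \<and> d < 1 \<and> v \<in> verts A \<and> 0 < \<epsilon> \<longrightarrow>
         (VAL A (of_rat d) v > of_rat c + of_rat \<epsilon> \<longrightarrow> f (instance_encode A d v \<epsilon> c) = Some Yes) \<and>
         (VAL A (of_rat d) v < of_rat c - of_rat \<epsilon> \<longrightarrow> f (instance_encode A d v \<epsilon> c) = Some No))"
proof -
  obtain adv where VAL: "VAL = (\<lambda>A d v. if adv then ASV A d v else CSV A d v)"
    using assms by (metis (mono_tags, lifting) ext insertE singletonD)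
  obtain f where f: "partial_recursive f"
    "\<And>x. \<exists>y. valid x y \<Longrightarrow> \<exists>y. valid x y \<and> f (enc x) = Some (enc (answer adv x y))"
    using partial_recursive_search[OF computable_valid computable_answer surj_enc_certificate] by metis
  show ?thesis
  proof (intro exI conjI allI impI)
    show "partial_recursive (\<lambda>n. Option.bind (Some (recode n)) f)"
      using f(1) total_recursive_recode unfolding total_recursive_def by (rule partial_recursive.comp)
  next
    fix A :: "nat arena" and d :: rat and v and \<epsilon> c :: rat
    assume "is_arena A \<and> 0 < d \<and> d < 1 \<and> v \<in> verts A \<and> 0 < \<epsilon>"
    then have A: "is_arena A" and d: "0 < d" "d < 1" and v: "v \<in> verts A" and \<epsilon>: "0 < \<epsilon>" by auto
    obtain a b where qd: "quotient_of d = (a, b)" by fastforce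
    obtain e e' where qe: "quotient_of \<epsilon> = (e, e')" by fastforce
    obtain k k' where qk: "quotient_of c = (k, k')" by fastforce
    have pos: "0 < b" "0 < e'" "0 < k'"
      using qd qe qk quotient_of_denom_pos by blast+
    have frac: "d = of_int a / of_int b" "\<epsilon> = of_int e / of_int e'" "c = of_int k / of_int k'"
      using qd qe qk quotient_of_div by blast+
    have a: "0 < a" "a < b" and e_pos: "0 < e"
      using d \<epsilon> pos by (simp_all add: frac zero_less_divide_iff)
    have real: "real_of_rat d = of_int a / of_int b" "real_of_rat \<epsilon> = of_int e / of_int e'"
      "real_of_rat c = of_int k / of_int k'"
      by (simp_all add: frac of_rat_divide)
    have fin: "finite (verts A)" "owned A i \<subseteq> verts A" "edges A \<subseteq> verts A \<times> verts A" for i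
      using A by (cases i; auto simp: is_arena_def)+
    then have fin_owned: "finite (owned A i)" and fin_edges: "finite (edges A)" for i
      by (auto intro: finite_subset)
    define V0 V1 where "V0 = sorted_list_of_set (owned A P0)" and "V1 = sorted_list_of_set (owned A P1)"
    define code where "code x = (x, weight A P0 x, weight A P1 x)" for x
    \<comment> \<open>The code of the edge set lists edge codes in increasing order. Decoding that
      very list makes the code of \<open>E\<close> agree with it, with no need to describe the order
      on the edges themselves.\<close>
    define E where "E = map (inv (enc :: coded_edge \<Rightarrow> nat)) (sorted_list_of_set (edge_encode A ` edges A))"
    have enc_code: "enc (code x) = edge_encode A x" for x
      by (simp add: code_def edge_encode_def enc_prod_def enc_nat_def enc_int_def)
    have surj_edge: "surj (enc :: coded_edge \<Rightarrow> nat)"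
      by (intro surj_enc_prod surj_enc_nat surj_enc_int)
    have set_E: "set E = code ` edges A"
      using fin_edges by (simp add: E_def image_image inv_f_f[OF inj_enc] flip: enc_code)
    have enc_E: "enc E = finset_encode (edge_encode A ` edges A)"
      by (simp add: E_def enc_list_def finset_encode_def o_def surj_f_inv_f[OF surj_edge])
    interpret coded_game A V0 V1 E a b
      using A a fin_owned by unfold_locales (simp_all add: V0_def V1_def set_E code_def)
    define x where "x = (V0, V1, E, (a, b), v, (e, e'), (k, k'))"
    have "recode (instance_encode A d v \<epsilon> c) = enc x"
      using qd qe qk enc_E
      by (simp add: recode_def instance_encode_def arena_encode_def rat_encode_def x_def enc_prod_def
          enc_nat_list enc_nat_def enc_int_def finset_encode_def V0_def V1_def)
    moreover obtain y where y: "valid x y" "f (enc x) = Some (enc (answer adv x y))"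
      using f(2) ex_valid[OF e_pos pos(2)] unfolding x_def by blast
    ultimately have out: "Option.bind (Some (recode (instance_encode A d v \<epsilon> c))) f = Some (of_bool (answer adv x y))"
      by (simp add: enc_bool_def)
    note ans = valid_answer[OF y(1)[unfolded x_def] v pos(2,3), folded x_def]
    have d_real: "real_of_rat d = coded_game.d a b"
      by (simp add: real d_def)
    show "Option.bind (Some (recode (instance_encode A d v \<epsilon> c))) f = Some Yes"
      if "of_rat c + of_rat \<epsilon> < VAL A (of_rat d) v"
      unfolding out using ans(1)[of adv] that unfolding VAL d_real real(2,3) by simp
    show "Option.bind (Some (recode (instance_encode A d v \<epsilon> c))) f = Some No"
      if "VAL A (of_rat d) v < of_rat c - of_rat \<epsilon>"
      unfolding out using ans(2)[of adv] that unfolding VAL d_real real(2,3) by simp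
  qed
qed

end
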